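(* Let $\alpha,\beta\in[0,2\pi)$ with $\beta\notin\{\alpha,\alpha\pm\pi\}$, and let $$u=\frac{1}{\sqrt2}\begin{bmatrix}1&1\\ e^{i\alpha}&-e^{i\alpha}\end{bmatrix},\qquad v=\frac{1}{\sqrt2}\begin{bmatrix}1&1\\ e^{i\beta}&-e^{i\beta}\end{bmatrix}.$$ Then the quadruple of $II_1$ factors $(R_u\cap R_v\subset R_u,R_v\subset R)$ is always non-degenerate, that is, $\overline{R_uR_v}=\overline{R_vR_u}=R$.
   Context: Closures are in the strong operator topology, and $R_uR_v$ denotes the linear span of products $xy$ with $x\in R_u$, $y\in R_v$. Spin model subfactors (for $n=2$). $M_n$ is the algebra of complex $n\times n$ matrices, $\Delta_n\subset M_n$ the diagonal subalgebra, $E_{ij}$ the matrix units, $J_n=\frac1n\sum_{i,j}E_{ij}$. A complex Hadamard matrix means here a unitary $u\in M_n$ all of whose entries have modulus $1/\sqrt n$. Consider the tower $A_{-1}=\Delta_n\subset A_0=M_n\subset A_1=\Delta_n\otimes M_n\subset A_2=M_n\otimes M_n\subset\cdots$, i.e. $A_{2k}=M_n^{\otimes (k+1)}$, $A_{2k+1}=\Delta_n\otimes M_n^{\otimes(k+1)}$, where $A_{2k}\subset A_{2k+1}$ via $x\mapsto I_n\otimes x$ and $A_{2k+1}\subset A_{2k+2}$ is induced by $\Delta_n\subset M_n$. This is a tower of Jones basic constructions with Jones projections $e_{2k+1}=\sum_i E_{ii}\otimes E_{ii}\otimes I_n^{\otimes k}\in A_{2k+1}$ ($k\ge0$) and $e_{2k}=J_n\otimes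 I_n^{\otimes k}\in A_{2k}$ ($k\ge 1$). $R$ is the hyperfinite $II_1$ factor obtained as the SOT-closure of $\bigcup_k A_k$ in the GNS representation of the normalized trace. The spin model subfactor $R_u\subset R$ is the von Neumann subalgebra generated by $u\Delta_nu^*\subset A_0$ and all $e_j$, $j\ge1$. The same $R$ and $e_j$ are used for $u$ and $v$. The condition $\beta\notin\{\alpha,\alpha\pm\pi\}$ is equivalent to $v\ne uPD$ for every permutation matrix $P$ and diagonal unitary $D$ (written $u\nsim v$), and to $R_u\ne R_v$; in this situation $R_u\cap R_v$ is a $II_1$ factor. *)

theory Defs
  imports "HOL-Analysis.Analysis"
begin

text \<open>
  The Hilbert space completion of an inner product space: Cauchy sequences modulo null sequences.
\<close>

definition cauchy_equiv :: "(nat \<Rightarrow> 'a::real_inner) \<Rightarrow> (nat \<Rightarrow> 'a) \<Rightarrow> bool" where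
  "cauchy_equiv x y \<longleftrightarrow> Cauchy x \<and> Cauchy y \<and> (\<lambda>n. x n - y n) \<longlonglongrightarrow> 0"

lemma Cauchy_constant: "Cauchy (\<lambda>_. x :: 'a::metric_space)"
  by (simp add: Cauchy_def)

lemma part_equivp_cauchy_equiv: "part_equivp (cauchy_equiv :: (nat \<Rightarrow> 'a::real_inner) \<Rightarrow> _)"
proof (rule part_equivpI)
  show "\<exists>x. cauchy_equiv x (x :: nat \<Rightarrow> 'a)"
    by (rule exI[of _ "\<lambda>_. 0"]) (simp add: cauchy_equiv_def Cauchy_constant)
  show "symp (cauchy_equiv :: (nat \<Rightarrow> 'a::real_inner) \<Rightarrow> _)"
  proof (rule sympI)
    fix x y :: "nat \<Rightarrow> 'a" assume "cauchy_equiv x y"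
    then show "cauchy_equiv y x"
      using tendsto_minus[of "\<lambda>n. x n - y n" 0 sequentially] by (simp add: cauchy_equiv_def)
  qed
  show "transp (cauchy_equiv :: (nat \<Rightarrow> 'a::real_inner) \<Rightarrow> _)"
  proof (rule transpI)
    fix x y z :: "nat \<Rightarrow> 'a" assume "cauchy_equiv x y" "cauchy_equiv y z"
    then show "cauchy_equiv x z"
      using tendsto_add[of "\<lambda>n. x n - y n" 0 sequentially "\<lambda>n. y n - z n" 0] by (simp add: cauchy_equiv_def)
  qed
qed

quotient_type (overloaded) 'a hcompletion = "nat \<Rightarrow> 'a::real_inner" / partial: cauchy_equiv
  by (rule part_equivp_cauchy_equiv)

lemma Cauchy_scaleR: "Cauchy x \<Longrightarrow> Cauchy (\<lambda>n. r *\<^sub>R (x n :: 'a::real_normed_vector))"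
  by (rule bounded_linear.Cauchy[OF bounded_linear_scaleR_right])

lemma Cauchy_add': "Cauchy x \<Longrightarrow> Cauchy y \<Longrightarrow> Cauchy (\<lambda>n. x n + (y n :: 'a::real_normed_vector))"
proof (rule CauchyI)
  fix e :: real assume x: "Cauchy x" and y: "Cauchy y" and e: "0 < e"
  obtain M where M: "\<And>m n. m \<ge> M \<Longrightarrow> n \<ge> M \<Longrightarrow> norm (x m - x n) < e/2"
    using CauchyD[OF x, of "e/2"] e by auto
  obtain N where N: "\<And>m n. m \<ge> N \<Longrightarrow> n \<ge> N \<Longrightarrow> norm (y m - y n) < e/2"
    using CauchyD[OF y, of "e/2"] e by auto
  show "\<exists>M. \<forall>m\<ge>M. \<forall>n\<ge>M. norm (x m + y m - (x n + y n)) < e"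
  proof (intro exI[of _ "max M N"] allI impI)
    fix m n assume "max M N \<le> m" "max M N \<le> n"
    then have "norm (x m - x n) < e/2" "norm (y m - y n) < e/2" using M N by auto
    then show "norm (x m + y m - (x n + y n)) < e"
      using norm_triangle_ineq[of "x m - x n" "y m - y n"] by (simp add: algebra_simps)
  qed
qed

lemma inner_convergent:
  assumes "Cauchy x" "Cauchy (y :: nat \<Rightarrow> 'a::real_inner)"
  shows "convergent (\<lambda>n. x n \<bullet> y n)"
proof -
  obtain K where K: "K > 0" "\<And>n. norm (x n) \<le> K"
    using Cauchy_Bseq[OF assms(1)] unfolding Bseq_def by auto
  obtain L where L: "L > 0" "\<And>n. norm (y n) \<le> L"
    using Cauchy_Bseq[OF assms(2)] unfolding Bseq_def by auto
  have "Cauchy (\<lambda>n. x n \<bullet> y n)"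
  proof (rule CauchyI)
    fix e :: real assume e: "e > 0"
    obtain M where M: "\<And>m n. m \<ge> M \<Longrightarrow> n \<ge> M \<Longrightarrow> norm (x m - x n) < e/(2*L)"
      using CauchyD[OF assms(1), of "e/(2*L)"] e L(1) by auto
    obtain N where N: "\<And>m n. m \<ge> N \<Longrightarrow> n \<ge> N \<Longrightarrow> norm (y m - y n) < e/(2*K)"
      using CauchyD[OF assms(2), of "e/(2*K)"] e K(1) by auto
    show "\<exists>M. \<forall>m\<ge>M. \<forall>n\<ge>M. norm (x m \<bullet> y m - x n \<bullet> y n) < e"
    proof (intro exI[of _ "max M N"] allI impI)
      fix m n assume mn: "max M N \<le> m" "max M N \<le> n"
      have "x m \<bullet> y m - x n \<bullet> y n = (x m - x n) \<bullet> y m + x n \<bullet> (y m - y n)"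
        by (simp add: inner_simps)
      then have "norm (x m \<bullet> y m - x n \<bullet> y n) \<le> norm (x m - x n) * norm (y m) + norm (x n) * norm (y m - y n)"
        using Cauchy_Schwarz_ineq2[of "x m - x n" "y m"] Cauchy_Schwarz_ineq2[of "x n" "y m - y n"] by simp
      also have "\<dots> \<le> norm (x m - x n) * L + K * norm (y m - y n)"
        by (intro add_mono mult_mono K L) (use K(1) in auto)
      also have "\<dots> < e/(2*L) * L + K * (e/(2*K))"
        using M[of m n] N[of m n] mn K(1) L(1) by (intro add_strict_mono mult_strict_right_mono mult_strict_left_mono) auto
      also have "\<dots> = e" using K(1) L(1) by (simp add: field_simps)
      finally show "norm (x m \<bullet> y m - x n \<bullet> y n) < e" .
    qed
  qed
  then show ?thesis by (simp add: Cauchy_convergent)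
qed

lemma inner_diff_tendsto_0:
  assumes "Cauchy x" "(y :: nat \<Rightarrow> 'a::real_inner) \<longlonglongrightarrow> 0"
  shows "(\<lambda>n. x n \<bullet> y n) \<longlonglongrightarrow> 0"
proof -
  obtain K where K: "K > 0" "\<And>n. norm (x n) \<le> K"
    using Cauchy_Bseq[OF assms(1)] unfolding Bseq_def by auto
  show ?thesis
  proof (rule Lim_null_comparison)
    show "\<forall>\<^sub>F n in sequentially. norm (x n \<bullet> y n) \<le> K * norm (y n)"
      by (intro always_eventually allI)
         (metis K(2) Cauchy_Schwarz_ineq2 mult_right_mono norm_ge_zero order_trans real_norm_def)
    show "(\<lambda>n. K * norm (y n)) \<longlonglongrightarrow> 0"
      using tendsto_mult_left[OF tendsto_norm_zero[OF assms(2)], of K] by simp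
  qed
qed

instantiation hcompletion :: (real_inner) real_inner
begin

lift_definition zero_hcompletion :: "'a hcompletion" is "\<lambda>_. 0"
  by (simp add: cauchy_equiv_def Cauchy_constant)

lift_definition plus_hcompletion :: "'a hcompletion \<Rightarrow> 'a hcompletion \<Rightarrow> 'a hcompletion"
  is "\<lambda>x y n. x n + y n"
  unfolding cauchy_equiv_def by (auto intro!: Cauchy_add' simp: add_diff_add tendsto_add_zero)

lift_definition uminus_hcompletion :: "'a hcompletion \<Rightarrow> 'a hcompletion" is "\<lambda>x n. - x n"
  unfolding cauchy_equiv_def
proof (intro conjI; elim conjE)
  fix x y :: "nat \<Rightarrow> 'a" assume "(\<lambda>n. x n - y n) \<longlonglongrightarrow> 0"
  from tendsto_minus[OF this] show "(\<lambda>n. - x n - - y n) \<longlonglongrightarrow> 0" by simp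
qed (auto simp: Cauchy_def dist_minus)

lift_definition scaleR_hcompletion :: "real \<Rightarrow> 'a hcompletion \<Rightarrow> 'a hcompletion" is "\<lambda>r x n. r *\<^sub>R x n"
  unfolding cauchy_equiv_def
proof (intro conjI; elim conjE)
  fix r and x y :: "nat \<Rightarrow> 'a" assume "(\<lambda>n. x n - y n) \<longlonglongrightarrow> 0"
  from tendsto_scaleR[OF tendsto_const this] show "(\<lambda>n. r *\<^sub>R x n - r *\<^sub>R y n) \<longlonglongrightarrow> 0"
    by (simp add: scaleR_diff_right)
qed (auto intro!: Cauchy_scaleR)

definition "x - y = x + - (y :: 'a hcompletion)"

lift_definition inner_hcompletion :: "'a hcompletion \<Rightarrow> 'a hcompletion \<Rightarrow> real"
  is "\<lambda>x y. lim (\<lambda>n. x n \<bullet> y n)"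
proof -
  fix x x' y y' :: "nat \<Rightarrow> 'a" assume a: "cauchy_equiv x x'" "cauchy_equiv y y'"
  then have c: "Cauchy x" "Cauchy x'" "Cauchy y" "Cauchy y'" by (auto simp: cauchy_equiv_def)
  have "(\<lambda>n. x' n \<bullet> y' n) \<longlonglongrightarrow> lim (\<lambda>n. x' n \<bullet> y' n)"
    using inner_convergent c by (simp flip: convergent_LIMSEQ_iff)
  moreover have "(\<lambda>n. y n \<bullet> (x n - x' n)) \<longlonglongrightarrow> 0" "(\<lambda>n. x' n \<bullet> (y n - y' n)) \<longlonglongrightarrow> 0"
    using a by (auto simp: cauchy_equiv_def intro!: inner_diff_tendsto_0)
  ultimately have "(\<lambda>n. x' n \<bullet> y' n + (y n \<bullet> (x n - x' n) + x' n \<bullet> (y n - y' n))) \<longlonglongrightarrow> lim (\<lambda>n. x' n \<bullet> y' n) + (0 + 0)"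
    by (intro tendsto_add)
  then have "(\<lambda>n. x n \<bullet> y n) \<longlonglongrightarrow> lim (\<lambda>n. x' n \<bullet> y' n)"
    by (simp add: inner_simps inner_commute)
  then show "lim (\<lambda>n. x n \<bullet> y n) = lim (\<lambda>n. x' n \<bullet> y' n)" by (rule limI)
qed

definition "norm x = sqrt (x \<bullet> (x :: 'a hcompletion))"
definition "dist x y = norm (x - (y :: 'a hcompletion))"
definition "sgn x = inverse (norm x) *\<^sub>R (x :: 'a hcompletion)"
definition "(uniformity :: ('a hcompletion \<times> 'a hcompletion) filter)
  = (INF e\<in>{0<..}. principal {(x, y). dist x y < e})"
definition "open (U :: 'a hcompletion set) \<longleftrightarrow> (\<forall>x\<in>U. eventually (\<lambda>(x', y). x' = x \<longrightarrow> y \<in> U) uniformity)"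

instance
proof
  fix x y z :: "'a hcompletion" and r s :: real and U :: "'a hcompletion set"
  have refl: "cauchy_equiv u u" if "Cauchy u" for u :: "nat \<Rightarrow> 'a"
    using that by (simp add: cauchy_equiv_def)
  show "x + y + z = x + (y + z)"
    by transfer (simp add: cauchy_equiv_def Cauchy_add' add.assoc)
  show "x + y = y + x"
    by transfer (simp add: cauchy_equiv_def Cauchy_add' add.commute)
  show "0 + x = x" by transfer (simp add: cauchy_equiv_def)
  show "- x + x = 0" by transfer (simp add: cauchy_equiv_def Cauchy_constant)
  show "x - y = x + - y" by (rule minus_hcompletion_def)
  show "r *\<^sub>R (x + y) = r *\<^sub>R x + r *\<^sub>R y"
    by transfer (simp add: cauchy_equiv_def Cauchy_add' Cauchy_scaleR scaleR_add_right)
  show "(r + s) *\<^sub>R x = r *\<^sub>R x + s *\<^sub>R x"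
    by transfer (simp add: cauchy_equiv_def Cauchy_add' Cauchy_scaleR scaleR_add_left)
  show "r *\<^sub>R s *\<^sub>R x = (r * s) *\<^sub>R x"
    by transfer (simp add: cauchy_equiv_def Cauchy_scaleR)
  show "1 *\<^sub>R x = x" by transfer (simp add: cauchy_equiv_def)
  show "x \<bullet> y = y \<bullet> x" by transfer (simp add: inner_commute)
  show "(x + y) \<bullet> z = x \<bullet> z + y \<bullet> z"
  proof transfer
    fix x y z :: "nat \<Rightarrow> 'a" assume "cauchy_equiv x x" "cauchy_equiv y y" "cauchy_equiv z z"
    then have "(\<lambda>n. x n \<bullet> z n + y n \<bullet> z n) \<longlonglongrightarrow> lim (\<lambda>n. x n \<bullet> z n) + lim (\<lambda>n. y n \<bullet> z n)"
      by (intro tendsto_add) (auto simp: cauchy_equiv_def inner_convergent simp flip: convergent_LIMSEQ_iff)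
    then show "lim (\<lambda>n. (x n + y n) \<bullet> z n) = lim (\<lambda>n. x n \<bullet> z n) + lim (\<lambda>n. y n \<bullet> z n)"
      by (simp add: inner_add_left limI)
  qed
  show "(r *\<^sub>R x) \<bullet> y = r * (x \<bullet> y)"
  proof transfer
    fix r and x y :: "nat \<Rightarrow> 'a" assume "cauchy_equiv x x" "cauchy_equiv y y"
    then have "(\<lambda>n. r * (x n \<bullet> y n)) \<longlonglongrightarrow> r * lim (\<lambda>n. x n \<bullet> y n)"
      by (intro tendsto_mult_left) (auto simp: cauchy_equiv_def inner_convergent simp flip: convergent_LIMSEQ_iff)
    then show "lim (\<lambda>n. (r *\<^sub>R x n) \<bullet> y n) = r * lim (\<lambda>n. x n \<bullet> y n)" by (simp add: limI)
  qed
  show "0 \<le> x \<bullet> x"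
  proof transfer
    fix x :: "nat \<Rightarrow> 'a" assume "cauchy_equiv x x"
    then have "(\<lambda>n. x n \<bullet> x n) \<longlonglongrightarrow> lim (\<lambda>n. x n \<bullet> x n)"
      by (auto simp: cauchy_equiv_def inner_convergent simp flip: convergent_LIMSEQ_iff)
    then show "0 \<le> lim (\<lambda>n. x n \<bullet> x n)" by (rule LIMSEQ_le_const) auto
  qed
  show "(x \<bullet> x = 0) = (x = 0)"
  proof transfer
    fix x :: "nat \<Rightarrow> 'a" assume x: "cauchy_equiv x x"
    then have l: "(\<lambda>n. x n \<bullet> x n) \<longlonglongrightarrow> lim (\<lambda>n. x n \<bullet> x n)"
      by (auto simp: cauchy_equiv_def inner_convergent simp flip: convergent_LIMSEQ_iff)
    show "(lim (\<lambda>n. x n \<bullet> x n) = 0) = cauchy_equiv x (\<lambda>_. 0)"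
    proof
      assume "lim (\<lambda>n. x n \<bullet> x n) = 0"
      with l have "(\<lambda>n. sqrt (x n \<bullet> x n)) \<longlonglongrightarrow> 0"
        using tendsto_real_sqrt by fastforce
      then have "x \<longlonglongrightarrow> 0" by (simp add: tendsto_norm_zero_iff flip: norm_eq_sqrt_inner)
      with x show "cauchy_equiv x (\<lambda>_. 0)"
        by (simp add: cauchy_equiv_def Cauchy_constant)
    next
      assume "cauchy_equiv x (\<lambda>_. 0)"
      then have "(\<lambda>n. x n \<bullet> x n) \<longlonglongrightarrow> (0::'a) \<bullet> 0"
        by (intro tendsto_inner) (auto simp: cauchy_equiv_def)
      then show "lim (\<lambda>n. x n \<bullet> x n) = 0" by (simp add: limI)
    qed
  qed
  show "norm x = sqrt (x \<bullet> x)" by (rule norm_hcompletion_def)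
  show "dist x y = norm (x - y)" by (rule dist_hcompletion_def)
  show "sgn x = inverse (norm x) *\<^sub>R x" by (rule sgn_hcompletion_def)
  show "(uniformity :: ('a hcompletion \<times> 'a hcompletion) filter)
    = (INF e\<in>{0<..}. principal {(x, y). dist x y < e})" by (rule uniformity_hcompletion_def)
  show "open U = (\<forall>x\<in>U. eventually (\<lambda>(x', y). x' = x \<longrightarrow> y \<in> U) uniformity)"
    by (rule open_hcompletion_def)
qed

end

lift_definition hembed :: "'a::real_inner \<Rightarrow> 'a hcompletion" is "\<lambda>x n. x"
  by (simp add: cauchy_equiv_def Cauchy_constant)

lemma hembed_add: "hembed (x + y) = hembed x + hembed y"
  by transfer (simp add: cauchy_equiv_def Cauchy_constant)

lemma hembed_scaleR: "hembed (r *\<^sub>R x) = r *\<^sub>R hembed x"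
  by transfer (simp add: cauchy_equiv_def Cauchy_constant)

lemma hembed_diff: "hembed (x - y) = hembed x - hembed y"
  using hembed_add[of x "- y"] hembed_scaleR[of "-1" y] by simp

lemma inner_hembed: "hembed x \<bullet> hembed y = x \<bullet> y"
  by transfer simp

lemma norm_hembed: "norm (hembed x) = norm x"
  by (simp add: norm_eq_sqrt_inner inner_hembed)

lemma abs_hcompletion_tendsto:
  assumes x: "Cauchy x"
  shows "(\<lambda>n. hembed (x n)) \<longlonglongrightarrow> abs_hcompletion x"
proof (rule LIMSEQ_I)
  fix e :: real assume e: "e > 0"
  obtain M where M: "\<And>m n. m \<ge> M \<Longrightarrow> n \<ge> M \<Longrightarrow> norm (x m - x n) < e/2"
    using CauchyD[OF x, of "e/2"] e by auto
  have "norm (hembed (x n) - abs_hcompletion x) < e" if n: "n \<ge> M" for n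
  proof -
    have ce: "cauchy_equiv x x" "cauchy_equiv (\<lambda>_. x n) (\<lambda>_. x n)"
      using x by (auto simp: cauchy_equiv_def Cauchy_constant)
    have cm: "cauchy_equiv (\<lambda>k. - x k) (\<lambda>k. - x k)"
      using x by (simp add: cauchy_equiv_def Cauchy_def dist_minus)
    have cd: "Cauchy (\<lambda>k. x n - x k)"
      using Cauchy_add'[of "\<lambda>_. x n" "\<lambda>k. - x k"] ce cm by (simp add: cauchy_equiv_def)
    have eq: "hembed (x n) - abs_hcompletion x = abs_hcompletion (\<lambda>k. x n - x k)"
      unfolding minus_hcompletion_def hembed.abs_eq
      by (subst uminus_hcompletion.abs_eq[OF ce(1)], subst plus_hcompletion.abs_eq[OF ce(2) cm]) simp
    have "cauchy_equiv (\<lambda>k. x n - x k) (\<lambda>k. x n - x k)" using cd by (simp add: cauchy_equiv_def)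
    then have "abs_hcompletion (\<lambda>k. x n - x k) \<bullet> abs_hcompletion (\<lambda>k. x n - x k)
        = lim (\<lambda>k. (x n - x k) \<bullet> (x n - x k))"
      by (simp add: inner_hcompletion.abs_eq)
    moreover have "lim (\<lambda>k. (x n - x k) \<bullet> (x n - x k)) \<le> (e/2)\<^sup>2"
    proof (rule LIMSEQ_le_const2)
      show "(\<lambda>k. (x n - x k) \<bullet> (x n - x k)) \<longlonglongrightarrow> lim (\<lambda>k. (x n - x k) \<bullet> (x n - x k))"
        using inner_convergent[OF cd cd] by (simp flip: convergent_LIMSEQ_iff)
      show "\<exists>N. \<forall>k\<ge>N. (x n - x k) \<bullet> (x n - x k) \<le> (e/2)\<^sup>2"
      proof (intro exI[of _ M] allI impI)
        fix k assume "k \<ge> M"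
        then have "norm (x n - x k) \<le> e/2" using M[OF n] by (simp add: less_imp_le)
        then show "(x n - x k) \<bullet> (x n - x k) \<le> (e/2)\<^sup>2"
          unfolding dot_square_norm by (rule power_mono) simp
      qed
    qed
    ultimately have "norm (hembed (x n) - abs_hcompletion x) \<le> e/2"
      unfolding eq norm_eq_sqrt_inner using e by (intro real_le_lsqrt) auto
    then show ?thesis using e by simp
  qed
  then show "\<exists>no. \<forall>n\<ge>no. norm (hembed (x n) - abs_hcompletion x) < e" by blast
qed

lemma hembed_dense: "\<exists>y. norm (hembed y - \<xi>) < e" if "e > 0"
proof -
  obtain x where x: "cauchy_equiv x x" "\<xi> = abs_hcompletion x"
    by (metis Quotient3_abs_rep Quotient3_hcompletion Quotient3_rep_reflp)
  have "(\<lambda>n. hembed (x n)) \<longlonglongrightarrow> \<xi>"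
    unfolding x(2) by (rule abs_hcompletion_tendsto) (use x in \<open>simp add: cauchy_equiv_def\<close>)
  from LIMSEQ_D[OF this that] show ?thesis by blast
qed

instance hcompletion :: (real_inner) complete_space
proof
  fix X :: "nat \<Rightarrow> 'a hcompletion" assume X: "Cauchy X"
  have "\<forall>n. \<exists>y. norm (hembed y - X n) < inverse (real (Suc n))"
    by (simp add: hembed_dense)
  then obtain y where y: "\<And>n. norm (hembed (y n) - X n) < inverse (real (Suc n))" by metis
  have d: "(\<lambda>n. hembed (y n) - X n) \<longlonglongrightarrow> 0"
    by (rule Lim_null_comparison[OF _ LIMSEQ_inverse_real_of_nat])
       (use y less_imp_le in \<open>auto intro!: always_eventually\<close>)
  have "Cauchy (\<lambda>n. X n + (hembed (y n) - X n))"
    by (rule Cauchy_add'[OF X]) (use d convergent_Cauchy convergentI in blast)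
  then have "Cauchy (\<lambda>n. hembed (y n))" by simp
  then have "Cauchy y"
    by (simp add: Cauchy_def dist_norm norm_hembed flip: hembed_diff)
  from tendsto_diff[OF abs_hcompletion_tendsto[OF this] d]
  show "convergent X" by (auto intro: convergentI)
qed

lift_definition hextend_fun :: "('a::real_inner \<Rightarrow>\<^sub>L 'b::real_inner) \<Rightarrow> 'a hcompletion \<Rightarrow> 'b hcompletion"
  is "\<lambda>T x n. blinfun_apply T (x n)"
proof -
  fix T :: "'a \<Rightarrow>\<^sub>L 'b" and x y :: "nat \<Rightarrow> 'a" assume "cauchy_equiv x y"
  then have "Cauchy x" "Cauchy y" and xy: "(\<lambda>n. x n - y n) \<longlonglongrightarrow> 0"
    by (auto simp: cauchy_equiv_def)
  moreover have "(\<lambda>n. T (x n - y n)) \<longlonglongrightarrow> T 0"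
    by (rule bounded_linear.tendsto[OF blinfun.bounded_linear_right xy])
  ultimately show "cauchy_equiv (\<lambda>n. T (x n)) (\<lambda>n. T (y n))"
    unfolding cauchy_equiv_def
    by (auto simp: blinfun.diff_right blinfun.zero_right intro!: bounded_linear.Cauchy[OF blinfun.bounded_linear_right])
qed

lemma hextend_fun_hembed: "hextend_fun T (hembed x) = hembed (T x)"
  by transfer (simp add: cauchy_equiv_def Cauchy_constant)

lemma hextend_fun_bound: "hextend_fun T x \<bullet> hextend_fun T x \<le> (norm T)\<^sup>2 * (x \<bullet> x)"
  for T :: "'a::real_inner \<Rightarrow>\<^sub>L 'b::real_inner"
proof (transfer fixing: T)
  fix x :: "nat \<Rightarrow> 'a" assume "cauchy_equiv x x"
  then have x: "Cauchy x" by (simp add: cauchy_equiv_def)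
  then have Tx: "Cauchy (\<lambda>n. T (x n))"
    by (rule bounded_linear.Cauchy[OF blinfun.bounded_linear_right])
  show "lim (\<lambda>n. T (x n) \<bullet> T (x n)) \<le> (norm T)\<^sup>2 * lim (\<lambda>n. x n \<bullet> x n)"
  proof (rule LIMSEQ_le)
    show "(\<lambda>n. T (x n) \<bullet> T (x n)) \<longlonglongrightarrow> lim (\<lambda>n. T (x n) \<bullet> T (x n))"
      using inner_convergent[OF Tx Tx] by (simp flip: convergent_LIMSEQ_iff)
    show "(\<lambda>n. (norm T)\<^sup>2 * (x n \<bullet> x n)) \<longlonglongrightarrow> (norm T)\<^sup>2 * lim (\<lambda>n. x n \<bullet> x n)"
      using inner_convergent[OF x x] by (intro tendsto_mult_left) (simp flip: convergent_LIMSEQ_iff)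
    show "\<exists>N. \<forall>n\<ge>N. T (x n) \<bullet> T (x n) \<le> (norm T)\<^sup>2 * (x n \<bullet> x n)"
      by (auto simp: dot_square_norm simp flip: power_mult_distrib intro!: power_mono norm_blinfun)
  qed
qed

lemma bounded_linear_hextend_fun: "bounded_linear (hextend_fun T)"
proof (rule bounded_linear_intro[where K = "norm T"])
  fix x y r
  have C: "Cauchy u \<Longrightarrow> Cauchy (\<lambda>n. T (u n))" for u
    by (rule bounded_linear.Cauchy[OF blinfun.bounded_linear_right])
  show "hextend_fun T (x + y) = hextend_fun T x + hextend_fun T y"
    by transfer (simp add: cauchy_equiv_def blinfun.add_right Cauchy_add'
      bounded_linear.Cauchy[OF blinfun.bounded_linear_right])
  show "hextend_fun T (r *\<^sub>R x) = r *\<^sub>R hextend_fun T x"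
    by transfer (simp add: cauchy_equiv_def blinfun.scaleR_right Cauchy_scaleR
      bounded_linear.Cauchy[OF blinfun.bounded_linear_right])
  have "hextend_fun T x \<bullet> hextend_fun T x \<le> (norm T)\<^sup>2 * (x \<bullet> x)" by (rule hextend_fun_bound)
  then show "norm (hextend_fun T x) \<le> norm x * norm T"
    unfolding norm_eq_sqrt_inner[of "hextend_fun T x"] norm_eq_sqrt_inner[of x]
    by (intro real_le_lsqrt) (auto simp: power_mult_distrib mult.commute)
qed

text \<open>
  The continuous extension of a bounded operator to the completions.
\<close>

definition hextend :: "('a::real_inner \<Rightarrow>\<^sub>L 'b::real_inner) \<Rightarrow> 'a hcompletion \<Rightarrow>\<^sub>L 'b hcompletion" where
  "hextend T = Blinfun (hextend_fun T)"

lemma hextend_apply: "blinfun_apply (hextend T) = hextend_fun T"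
  by (simp add: hextend_def bounded_linear_Blinfun_apply bounded_linear_hextend_fun)

text \<open>
  The union of the tower $A_0 \subset A_1 \subset \cdots$ is the inductive limit of the algebras
  $M_n^{\otimes k}$ along $x \mapsto I_n \otimes x$. Tensor positions are numbered from the right,
  starting at 0, so that new factors are added at the highest position. An element of
  $M_n^{\otimes k}$ is a matrix whose rows and columns are indexed by functions on
  \<open>{..<k}\<close>; together with all its images $I_n \otimes \cdots \otimes I_n \otimes x$ it is represented
  by the single kernel \<open>X f g\<close> on infinite index sequences that vanishes unless \<open>f\<close> and \<open>g\<close>
  agree from position \<open>k\<close> on, and that only depends on the first \<open>k\<close> positions otherwise.
  With this encoding all inclusions of the tower are inclusions of sets. The size $n$ is the
  cardinality of the index type.
\<close>

abbreviation idx :: "nat \<Rightarrow> (nat \<Rightarrow> 'n) set" where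
  "idx k \<equiv> {..<k} \<rightarrow>\<^sub>E UNIV"

abbreviation cutoff :: "nat \<Rightarrow> (nat \<Rightarrow> 'n) \<Rightarrow> nat \<Rightarrow> 'n" where
  "cutoff k f \<equiv> restrict f {..<k}"

definition agree :: "nat \<Rightarrow> (nat \<Rightarrow> 'n) \<Rightarrow> (nat \<Rightarrow> 'n) \<Rightarrow> bool" where
  "agree k f g \<longleftrightarrow> (\<forall>j\<ge>k. f j = g j)"

definition in_level :: "nat \<Rightarrow> ((nat \<Rightarrow> 'n) \<Rightarrow> (nat \<Rightarrow> 'n) \<Rightarrow> complex) \<Rightarrow> bool" where
  "in_level k X \<longleftrightarrow> (\<forall>f g. X f g = (if agree k f g then X (cutoff k f) (cutoff k g) else 0))"

lemma in_levelD:
  "in_level k X \<Longrightarrow> \<not> agree k f g \<Longrightarrow> X f g = 0"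
  "in_level k X \<Longrightarrow> agree k f g \<Longrightarrow> X f g = X (cutoff k f) (cutoff k g)"
  unfolding in_level_def by (drule spec[of _ f], drule spec[of _ g], simp only: if_True if_False simp_thms)+

lemma cutoff_in_idx [simp]: "cutoff k f \<in> idx k" by auto

lemma cut_idx [simp]: "p \<in> idx k \<Longrightarrow> cutoff k p = p"
  by (auto simp: PiE_iff extensional_def)

lemma finite_idx [simp]: "finite (idx k :: (nat \<Rightarrow> 'n::finite) set)"
  by (rule finite_PiE) auto

lemma agree_idx [simp]: "p \<in> idx k \<Longrightarrow> q \<in> idx k \<Longrightarrow> agree k p q"
  by (auto simp: agree_def PiE_iff extensional_def)

lemma agree_refl [simp]: "agree k f f" by (simp add: agree_def)
lemma agree_sym: "agree k f g \<longleftrightarrow> agree k g f" by (auto simp: agree_def)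
lemma agree_trans: "agree k f g \<Longrightarrow> agree k g h \<Longrightarrow> agree k f h" by (auto simp: agree_def)

lemma in_level_mono:
  assumes X: "in_level k X" and kl: "k \<le> l"
  shows "in_level l X"
  unfolding in_level_def
proof (intro allI)
  fix f g
  have c: "cutoff k (cutoff l h) = cutoff k h" for h :: "nat \<Rightarrow> 'a" using kl by (auto simp: fun_eq_iff)
  have X': "X a b = (if agree k a b then X (cutoff k a) (cutoff k b) else 0)" for a b
    using X unfolding in_level_def by blast
  show "X f g = (if agree l f g then X (cutoff l f) (cutoff l g) else 0)"
  proof (cases "agree k f g")
    case True
    then have "agree l f g" "agree k (cutoff l f) (cutoff l g)" using kl by (auto simp: agree_def)
    with True show ?thesis by (simp add: X'[of f g] X'[of "cutoff l f" "cutoff l g"] c del: restrict_restrict)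
  next
    case False
    then have "\<not> agree l f g \<or> \<not> agree k (cutoff l f) (cutoff l g)"
      unfolding agree_def restrict_def by (metis lessThan_iff not_le_imp_less)
    with False show ?thesis by (auto simp: X'[of f g] X'[of "cutoff l f" "cutoff l g"])
  qed
qed

lemma in_level_ext:
  assumes "in_level k X" "in_level k Y" "\<And>p q. p \<in> idx k \<Longrightarrow> q \<in> idx k \<Longrightarrow> X p q = Y p q"
  shows "X = Y"
proof (intro ext)
  fix f g
  show "X f g = Y f g"
    using in_levelD[OF assms(1), of f g] in_levelD[OF assms(2), of f g] assms(3)[of "cutoff k f" "cutoff k g"]
    by (cases "agree k f g") simp_all
qed

definition nb :: "nat \<Rightarrow> (nat \<Rightarrow> 'n) \<Rightarrow> (nat \<Rightarrow> 'n) set" where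
  "nb k f = {g. agree k f g}"

lemma bij_cut_nb: "bij_betw (cutoff k) (nb k f) (idx k)"
proof (rule bij_betwI[where g = "\<lambda>p j. if j < k then p j else f j"])
  show "cutoff k \<in> nb k f \<rightarrow> idx k" by auto
  show "(\<lambda>p j. if j < k then p j else f j) \<in> idx k \<rightarrow> nb k f" by (auto simp: nb_def agree_def)
  show "(\<lambda>j. if j < k then cutoff k g j else f j) = g" if "g \<in> nb k f" for g
    using that by (auto simp: nb_def agree_def fun_eq_iff)
  show "cutoff k (\<lambda>j. if j < k then p j else f j) = p" if "p \<in> idx k" for p
    using that by (auto simp: fun_eq_iff restrict_def PiE_iff extensional_def)
qed

lemma finite_nb [simp]: "finite (nb k (f :: nat \<Rightarrow> 'n::finite))"
  using bij_betw_finite[OF bij_cut_nb[of k f]] by simp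

lemma card_nb: "card (nb k (f :: nat \<Rightarrow> 'n::finite)) = CARD('n) ^ k"
  using bij_betw_same_card[OF bij_cut_nb[of k f]] by (simp add: card_PiE)

text \<open>
  The matrix product. The sum over the column index of \<open>X\<close> is finite for every kernel of
  some level.
\<close>

definition mmul :: "((nat \<Rightarrow> 'n) \<Rightarrow> (nat \<Rightarrow> 'n) \<Rightarrow> complex) \<Rightarrow> ((nat \<Rightarrow> 'n) \<Rightarrow> (nat \<Rightarrow> 'n) \<Rightarrow> complex)
    \<Rightarrow> (nat \<Rightarrow> 'n) \<Rightarrow> (nat \<Rightarrow> 'n) \<Rightarrow> complex" where
  "mmul X Y f h = (\<Sum>g | X f g \<noteq> 0. X f g * Y g h)"

lemma mmul_nb:
  fixes X :: "(nat \<Rightarrow> 'n::finite) \<Rightarrow> (nat \<Rightarrow> 'n) \<Rightarrow> complex"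
  assumes "in_level k X"
  shows "mmul X Y f h = (\<Sum>g\<in>nb k f. X f g * Y g h)"
  unfolding mmul_def
proof (rule sum.mono_neutral_left)
  show "{g. X f g \<noteq> 0} \<subseteq> nb k f"
    using in_levelD(1)[OF assms] by (auto simp: nb_def)
qed auto

lemma mmul_level:
  fixes X :: "(nat \<Rightarrow> 'n::finite) \<Rightarrow> (nat \<Rightarrow> 'n) \<Rightarrow> complex"
  assumes X: "in_level k X" and Y: "in_level k Y"
  shows "mmul X Y f h = (if agree k f h then \<Sum>p\<in>idx k. X (cutoff k f) p * Y p (cutoff k h) else 0)"
proof -
  have "mmul X Y f h = (\<Sum>g\<in>nb k f. if agree k f h then X (cutoff k f) (cutoff k g) * Y (cutoff k g) (cutoff k h) else 0)"
    unfolding mmul_nb[OF X]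
  proof (rule sum.cong[OF refl])
    fix g assume "g \<in> nb k f"
    then have g: "agree k f g" by (simp add: nb_def)
    then have "agree k g h \<longleftrightarrow> agree k f h" using agree_trans agree_sym by metis
    then show "X f g * Y g h = (if agree k f h then X (cutoff k f) (cutoff k g) * Y (cutoff k g) (cutoff k h) else 0)"
      using in_levelD(2)[OF X g] in_levelD[OF Y, of g h] by auto
  qed
  then show ?thesis
    using sum.reindex_bij_betw[OF bij_cut_nb[of k f], of "\<lambda>p. X (cutoff k f) p * Y p (cutoff k h)"] by simp
qed

lemma mmul_idx:
  fixes X :: "(nat \<Rightarrow> 'n::finite) \<Rightarrow> (nat \<Rightarrow> 'n) \<Rightarrow> complex"
  assumes "in_level k X" "in_level k Y" "p \<in> idx k" "q \<in> idx k"
  shows "mmul X Y p q = (\<Sum>r\<in>idx k. X p r * Y r q)"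
  using assms by (simp add: mmul_level)

lemma in_level_mmul:
  fixes X :: "(nat \<Rightarrow> 'n::finite) \<Rightarrow> (nat \<Rightarrow> 'n) \<Rightarrow> complex"
  assumes "in_level k X" "in_level k Y"
  shows "in_level k (mmul X Y)"
  unfolding in_level_def mmul_level[OF assms] by simp

lemma in_level_linear:
  "in_level k (\<lambda>f g. 0)"
  "in_level k X \<Longrightarrow> in_level k Y \<Longrightarrow> in_level k (\<lambda>f g. X f g + Y f g)"
  "in_level k X \<Longrightarrow> in_level k (\<lambda>f g. c * X f g)"
  "in_level k X \<Longrightarrow> in_level k (\<lambda>f g. - X f g)"
  "in_level k X \<Longrightarrow> in_level k (\<lambda>f g. cnj (X g f))"
proof -
  show "in_level k (\<lambda>f g. 0)" by (simp add: in_level_def)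
  show "in_level k (\<lambda>f g. X f g + Y f g)" if "in_level k X" "in_level k Y"
    unfolding in_level_def
    by (metis (full_types) in_levelD[OF that(1)] in_levelD[OF that(2)] add_0)
  show "in_level k (\<lambda>f g. c * X f g)" if "in_level k X"
    unfolding in_level_def by (metis (full_types) in_levelD[OF that] mult_zero_right)
  show "in_level k (\<lambda>f g. - X f g)" if "in_level k X"
    unfolding in_level_def by (metis (full_types) in_levelD[OF that] neg_0_equal_iff_equal)
  show "in_level k (\<lambda>f g. cnj (X g f))" if "in_level k X"
    unfolding in_level_def using in_levelD[OF that] agree_sym by (metis complex_cnj_zero)
qed

lemma in_level_id: "in_level k (\<lambda>f g. if f = g then 1 else 0)"
proof -
  have "in_level 0 (\<lambda>f g :: nat \<Rightarrow> 'a. if f = g then 1 else 0)"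
    by (simp add: in_level_def agree_def fun_eq_iff)
  then show ?thesis by (rule in_level_mono) simp
qed

typedef ('n::finite) tower = "{X :: (nat \<Rightarrow> 'n) \<Rightarrow> (nat \<Rightarrow> 'n) \<Rightarrow> complex. \<exists>k. in_level k X}"
  by (rule exI[of _ "\<lambda>f g. 0"]) (use in_level_linear(1) in blast)

setup_lifting type_definition_tower

lemma common_level2:
  assumes "\<exists>k. in_level k X" "\<exists>k. in_level k Y"
  obtains k where "in_level k X" "in_level k Y"
  using assms by (meson in_level_mono nat_le_linear)

instantiation tower :: (finite) ring_1
begin

lift_definition zero_tower :: "'a tower" is "\<lambda>f g. 0"
  using in_level_linear(1) by blast
lift_definition one_tower :: "'a tower" is "\<lambda>f g. if f = g then 1 else 0"
  using in_level_id by blast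
lift_definition plus_tower :: "'a tower \<Rightarrow> 'a tower \<Rightarrow> 'a tower" is "\<lambda>X Y f g. X f g + Y f g"
  by (erule (1) common_level2) (use in_level_linear(2) in blast)
lift_definition uminus_tower :: "'a tower \<Rightarrow> 'a tower" is "\<lambda>X f g. - X f g"
  using in_level_linear(4) by blast
definition minus_tower :: "'a tower \<Rightarrow> 'a tower \<Rightarrow> 'a tower" where "X - Y = X + - (Y :: 'a tower)"
lift_definition times_tower :: "'a tower \<Rightarrow> 'a tower \<Rightarrow> 'a tower" is mmul
  by (erule (1) common_level2) (use in_level_mmul in blast)

instance
proof
  fix X Y Z :: "'a tower"
  show "X + Y + Z = X + (Y + Z)" by transfer (simp add: add.assoc)
  show "X + Y = Y + X" by transfer (simp add: add.commute)
  show "0 + X = X" by transfer simp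
  show "- X + X = 0" by transfer simp
  show "X - Y = X + - Y" by (rule minus_tower_def)
  show "(0::'a tower) \<noteq> 1" by transfer (auto simp: fun_eq_iff)
  show "1 * X = X"
  proof transfer
    fix X :: "(nat \<Rightarrow> 'a) \<Rightarrow> (nat \<Rightarrow> 'a) \<Rightarrow> complex"
    show "mmul (\<lambda>f g. if f = g then 1 else 0) X = X"
      by (intro ext) (simp add: mmul_def)
  qed
  show "X * 1 = X"
  proof transfer
    fix X :: "(nat \<Rightarrow> 'a) \<Rightarrow> (nat \<Rightarrow> 'a) \<Rightarrow> complex" assume "\<exists>k. in_level k X"
    then obtain k where k: "in_level k X" by blast
    show "mmul X (\<lambda>f g. if f = g then 1 else 0) = X"
    proof (rule in_level_ext[OF in_level_mmul[OF k in_level_id] k])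
      fix p q :: "nat \<Rightarrow> 'a" assume pq: "p \<in> idx k" "q \<in> idx k"
      show "mmul X (\<lambda>f g. if f = g then 1 else 0) p q = X p q"
        using pq by (simp add: mmul_idx[OF k in_level_id pq] if_distrib cong: if_cong)
    qed
  qed
  show "X * Y * Z = X * (Y * Z)"
  proof transfer
    fix X Y Z :: "(nat \<Rightarrow> 'a) \<Rightarrow> (nat \<Rightarrow> 'a) \<Rightarrow> complex"
    assume "\<exists>k. in_level k X" "\<exists>k. in_level k Y" "\<exists>k. in_level k Z"
    then obtain k where k: "in_level k X" "in_level k Y" "in_level k Z"
      by (metis in_level_mono nat_le_linear)
    note m = in_level_mmul[OF k(1,2)] in_level_mmul[OF k(2,3)]
    show "mmul (mmul X Y) Z = mmul X (mmul Y Z)"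
    proof (rule in_level_ext[OF in_level_mmul[OF m(1) k(3)] in_level_mmul[OF k(1) m(2)]])
      fix p q :: "nat \<Rightarrow> 'a" assume pq: "p \<in> idx k" "q \<in> idx k"
      have "mmul (mmul X Y) Z p q = (\<Sum>r\<in>idx k. (\<Sum>s\<in>idx k. X p s * Y s r) * Z r q)"
        unfolding mmul_idx[OF m(1) k(3) pq] by (rule sum.cong) (simp_all add: mmul_idx[OF k(1,2)] pq)
      also have "\<dots> = (\<Sum>s\<in>idx k. X p s * (\<Sum>r\<in>idx k. Y s r * Z r q))"
        unfolding sum_distrib_left sum_distrib_right by (subst sum.swap) (simp add: mult.assoc)
      also have "\<dots> = mmul X (mmul Y Z) p q"
        unfolding mmul_idx[OF k(1) m(2) pq] by (rule sum.cong) (simp_all add: mmul_idx[OF k(2,3)] pq)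
      finally show "mmul (mmul X Y) Z p q = mmul X (mmul Y Z) p q" .
    qed
  qed
  show "(X + Y) * Z = X * Z + Y * Z"
  proof transfer
    fix X Y Z :: "(nat \<Rightarrow> 'a) \<Rightarrow> (nat \<Rightarrow> 'a) \<Rightarrow> complex"
    assume "\<exists>k. in_level k X" "\<exists>k. in_level k Y"
    then obtain k where k: "in_level k X" "in_level k Y" by (rule common_level2)
    show "mmul (\<lambda>f g. X f g + Y f g) Z = (\<lambda>f g. mmul X Z f g + mmul Y Z f g)"
      by (intro ext) (simp add: mmul_nb[OF k(1)] mmul_nb[OF k(2)] mmul_nb[OF in_level_linear(2)[OF k]]
          distrib_right sum.distrib)
  qed
  show "X * (Y + Z) = X * Y + X * Z"
    by transfer (intro ext, simp add: mmul_def distrib_left sum.distrib)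
qed

end

lift_definition scaleC :: "complex \<Rightarrow> 'n::finite tower \<Rightarrow> 'n tower" is "\<lambda>c X f g. c * X f g"
  using in_level_linear(3) by blast

lift_definition star :: "'n::finite tower \<Rightarrow> 'n tower" is "\<lambda>X f g. cnj (X g f)"
  using in_level_linear(5) by blast

lift_definition level :: "nat \<Rightarrow> 'n::finite tower \<Rightarrow> bool" is in_level .

lift_definition entry :: "'n::finite tower \<Rightarrow> (nat \<Rightarrow> 'n) \<Rightarrow> (nat \<Rightarrow> 'n) \<Rightarrow> complex" is "\<lambda>X. X" .

text \<open>
  The normalized trace; the value does not depend on the level used (\<open>tr_level\<close>).
\<close>

definition tr :: "'n::finite tower \<Rightarrow> complex" where
  "tr X = (let k = (LEAST k. level k X) in (\<Sum>p\<in>idx k. entry X p p) / of_nat CARD('n) ^ k)"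

lemma sum_idx_Suc:
  fixes F :: "(nat \<Rightarrow> 'n::finite) \<Rightarrow> complex"
  shows "(\<Sum>p\<in>idx (Suc k). F (cutoff k p)) = of_nat CARD('n) * (\<Sum>p\<in>idx k. F p)"
proof -
  have inj: "inj_on (\<lambda>(y :: 'n, g). g(k := y)) (UNIV \<times> idx k)"
    using inj_combinator[of k "{..<k}" "\<lambda>_. UNIV :: 'n set"] by simp
  have "idx (Suc k) = (\<lambda>(y, g). g(k := y)) ` (UNIV \<times> (idx k :: (nat \<Rightarrow> 'n) set))"
    by (simp add: lessThan_Suc PiE_insert_eq)
  then have "(\<Sum>p\<in>idx (Suc k). F (cutoff k p))
      = (\<Sum>z\<in>UNIV \<times> idx k. F (cutoff k (case z of (y :: 'n, g) \<Rightarrow> g(k := y))))"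
    by (simp only: sum.reindex[OF inj] o_def)
  also have "\<dots> = (\<Sum>(y :: 'n, g)\<in>UNIV \<times> idx k. F (cutoff k (g(k := y))))"
    by (simp only: case_prod_unfold)
  also have "\<dots> = (\<Sum>(y :: 'n, g)\<in>UNIV \<times> idx k. F g)"
  proof (rule sum.cong[OF refl], clarify)
    fix y :: 'n and g :: "nat \<Rightarrow> 'n" assume "g \<in> idx k"
    then have "cutoff k (g(k := y)) = g" by (auto simp: fun_eq_iff restrict_def PiE_iff extensional_def)
    then show "F (cutoff k (g(k := y))) = F g" by simp
  qed
  also have "\<dots> = of_nat CARD('n) * (\<Sum>p\<in>idx k. F p)"
    by (simp flip: sum.cartesian_product)
  finally show ?thesis .
qed

lemma level_mono: "level k X \<Longrightarrow> k \<le> l \<Longrightarrow> level l X"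
  by transfer (rule in_level_mono)

lemma level_exists: "\<exists>k. level k X" by transfer

lemma entry_cut: "level k X \<Longrightarrow> agree k f g \<Longrightarrow> entry X f g = entry X (cutoff k f) (cutoff k g)"
  by transfer (rule in_levelD(2))

lemma tr_level:
  fixes X :: "'n::finite tower"
  assumes "level k X"
  shows "tr X = (\<Sum>p\<in>idx k. entry X p p) / of_nat CARD('n) ^ k"
proof -
  define m where "m = (LEAST k. level k X)"
  have m: "level m X" "m \<le> k" unfolding m_def using assms by (auto intro: LeastI Least_le)
  from m(2) have "(\<Sum>p\<in>idx k. entry X p p) / of_nat CARD('n) ^ k = (\<Sum>p\<in>idx m. entry X p p) / of_nat CARD('n) ^ m"
  proof (induction k rule: dec_induct)
    case (step k)
    have "(\<Sum>p\<in>idx (Suc k). entry X p p) = (\<Sum>p\<in>idx (Suc k). entry X (cutoff k p) (cutoff k p))"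
      by (rule sum.cong[OF refl], rule entry_cut) (use level_mono[OF m(1) step(1)] in auto)
    also have "\<dots> = of_nat CARD('n) * (\<Sum>p\<in>idx k. entry X p p)" by (rule sum_idx_Suc)
    finally show ?case using step.IH by simp
  qed simp
  then show ?thesis by (simp add: tr_def m_def Let_def)
qed

lemma level_ops:
  "level k X \<Longrightarrow> level k Y \<Longrightarrow> level k (X + Y)"
  "level k X \<Longrightarrow> level k Y \<Longrightarrow> level k (X * Y)"
  "level k X \<Longrightarrow> level k (scaleC c X)"
  "level k X \<Longrightarrow> level k (star X)"
  by (transfer, simp add: in_level_linear in_level_mmul)+

lemma entry_ops:
  "entry (X + Y) f g = entry X f g + entry Y f g"
  "entry (scaleC c X) f g = c * entry X f g"
  "entry (star X) f g = cnj (entry X g f)"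
  "entry 0 f g = 0"
  by (transfer, simp)+

lemma entry_mult_idx:
  "level k X \<Longrightarrow> level k Y \<Longrightarrow> p \<in> idx k \<Longrightarrow> q \<in> idx k \<Longrightarrow>
    entry (X * Y) p q = (\<Sum>r\<in>idx k. entry X p r * entry Y r q)"
  by transfer (rule mmul_idx)

lemma entry_mult_nb: "level k X \<Longrightarrow> entry (X * Y) f h = (\<Sum>g\<in>nb k f. entry X f g * entry Y g h)"
  by transfer (rule mmul_nb)

lemma tower_eqI:
  "level k X \<Longrightarrow> level k Y \<Longrightarrow> (\<And>p q. p \<in> idx k \<Longrightarrow> q \<in> idx k \<Longrightarrow> entry X p q = entry Y p q) \<Longrightarrow> X = Y"
  by transfer (rule in_level_ext)

text \<open>
  The inner product of the GNS construction is $\mathrm{tr}(Y^* X)$. As the library has real inner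
  product spaces only, its real part is used: it gives the same norm, and for complex linear
  operators the same adjoints. Since the trace is faithful, no quotient is needed.
\<close>

instantiation tower :: (finite) real_inner
begin

definition scaleR_tower :: "real \<Rightarrow> 'a tower \<Rightarrow> 'a tower" where
  "scaleR_tower r X = scaleC (complex_of_real r) X"
definition inner_tower :: "'a tower \<Rightarrow> 'a tower \<Rightarrow> real" where
  "X \<bullet> Y = Re (tr (star Y * X))"
definition "norm X = sqrt (X \<bullet> (X :: 'a tower))"
definition "dist X Y = norm (X - (Y :: 'a tower))"
definition "sgn X = inverse (norm X) *\<^sub>R (X :: 'a tower)"
definition "(uniformity :: ('a tower \<times> 'a tower) filter)
  = (INF e\<in>{0<..}. principal {(x, y). dist x y < e})"
definition "open (U :: 'a tower set) \<longleftrightarrow> (\<forall>x\<in>U. eventually (\<lambda>(x', y). x' = x \<longrightarrow> y \<in> U) uniformity)"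

lemma inner_tower_level:
  fixes X Y :: "'a tower"
  assumes "level k X" "level k Y"
  shows "X \<bullet> Y = (\<Sum>p\<in>idx k. \<Sum>q\<in>idx k. Re (cnj (entry Y q p) * entry X q p)) / real CARD('a) ^ k"
proof -
  have "tr (star Y * X) = (\<Sum>p\<in>idx k. \<Sum>q\<in>idx k. cnj (entry Y q p) * entry X q p) / of_nat CARD('a) ^ k"
    by (simp add: tr_level[OF level_ops(2)[OF level_ops(4)[OF assms(2)] assms(1)]]
        entry_mult_idx[OF level_ops(4)[OF assms(2)] assms(1)] entry_ops)
  moreover have "complex_of_nat CARD('a) ^ k = complex_of_real (real CARD('a) ^ k)" by simp
  ultimately show ?thesis unfolding inner_tower_def
    by (simp only: Re_divide_of_real Re_sum)
qed

lemma inner_tower_self: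
  fixes X :: "'a tower"
  assumes "level k X"
  shows "X \<bullet> X = (\<Sum>p\<in>idx k. \<Sum>q\<in>idx k. (cmod (entry X q p))\<^sup>2) / real CARD('a) ^ k"
  unfolding inner_tower_level[OF assms assms] cmod_power2 by (simp add: power2_eq_square)

instance
proof
  fix X Y Z :: "'a tower" and r s :: real and U :: "'a tower set"
  show "r *\<^sub>R (X + Y) = r *\<^sub>R X + r *\<^sub>R Y"
    unfolding scaleR_tower_def by transfer (simp add: distrib_left)
  show "(r + s) *\<^sub>R X = r *\<^sub>R X + s *\<^sub>R X"
    unfolding scaleR_tower_def by transfer (simp add: distrib_right)
  show "r *\<^sub>R s *\<^sub>R X = (r * s) *\<^sub>R X"
    unfolding scaleR_tower_def by transfer (simp add: mult.assoc)
  show "1 *\<^sub>R X = X"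
    unfolding scaleR_tower_def by transfer simp
  obtain k where k: "level k X" "level k Y" "level k Z"
    using level_exists[of X] level_exists[of Y] level_exists[of Z] by (metis level_mono nat_le_linear)
  show "X \<bullet> Y = Y \<bullet> X"
    unfolding inner_tower_level[OF k(1,2)] inner_tower_level[OF k(2,1)]
    by (simp add: mult.commute)
  show "(X + Y) \<bullet> Z = X \<bullet> Z + Y \<bullet> Z"
    unfolding inner_tower_level[OF level_ops(1)[OF k(1,2)] k(3)] inner_tower_level[OF k(1,3)]
      inner_tower_level[OF k(2,3)]
    by (simp add: entry_ops distrib_left sum.distrib add_divide_distrib algebra_simps)
  show "(r *\<^sub>R X) \<bullet> Y = r * (X \<bullet> Y)"
    unfolding scaleR_tower_def inner_tower_level[OF level_ops(3)[OF k(1)] k(2)] inner_tower_level[OF k(1,2)]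
    by (simp add: entry_ops sum_distrib_left algebra_simps)
  show "0 \<le> X \<bullet> X"
    unfolding inner_tower_self[OF k(1)] by (intro divide_nonneg_nonneg sum_nonneg) auto
  show "(X \<bullet> X = 0) = (X = 0)"
  proof
    assume "X \<bullet> X = 0"
    then have "\<forall>p\<in>idx k. \<forall>q\<in>idx k. entry X q p = 0"
      unfolding inner_tower_self[OF k(1)]
      by (simp add: sum_nonneg_eq_0_iff sum_nonneg)
    then show "X = 0"
      by (intro tower_eqI[OF k(1)]) (auto simp: entry_ops zero_tower.rep_eq level.rep_eq in_level_linear)
  next
    assume "X = 0"
    then show "X \<bullet> X = 0" unfolding inner_tower_self[OF k(1)] by (simp add: entry_ops)
  qed
  show "norm X = sqrt (X \<bullet> X)" by (rule norm_tower_def)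
  show "dist X Y = norm (X - Y)" by (rule dist_tower_def)
  show "sgn X = inverse (norm X) *\<^sub>R X" by (rule sgn_tower_def)
  show "(uniformity :: ('a tower \<times> 'a tower) filter)
    = (INF e\<in>{0<..}. principal {(x, y). dist x y < e})" by (rule uniformity_tower_def)
  show "open U = (\<forall>x\<in>U. eventually (\<lambda>(x', y). x' = x \<longrightarrow> y \<in> U) uniformity)"
    by (rule open_tower_def)
qed

end

lemma norm_scaleC: "norm (scaleC c X) = cmod c * norm X"
proof -
  obtain k where k: "level k X" using level_exists by blast
  have "scaleC c X \<bullet> scaleC c X = (cmod c)\<^sup>2 * (X \<bullet> X)"
    unfolding inner_tower_self[OF k] inner_tower_self[OF level_ops(3)[OF k]]
    by (simp add: entry_ops norm_mult power_mult_distrib sum_distrib_left)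
  then show ?thesis by (simp add: norm_tower_def real_sqrt_mult)
qed

lemma bounded_linear_scaleC: "bounded_linear (scaleC c)"
proof (rule bounded_linear_intro[where K = "cmod c"])
  show "scaleC c (X + Y) = scaleC c X + scaleC c Y" for X Y
    by transfer (simp add: distrib_left)
  show "scaleC c (r *\<^sub>R X) = r *\<^sub>R scaleC c X" for r X
    unfolding scaleR_tower_def by transfer (simp add: mult.left_commute)
  show "norm (scaleC c X) \<le> norm X * cmod c" for X by (simp add: norm_scaleC mult.commute)
qed

lemma mult_scaleC_right: "X * scaleC c Y = scaleC c (X * Y)"
  by transfer (intro ext, simp add: mmul_def sum_distrib_left mult.left_commute)

lemma bounded_linear_mult: "bounded_linear (\<lambda>X. a * X)" for a :: "'n::finite tower"
proof -
  obtain k where k: "level k a" using level_exists by blast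
  define A where "A = (\<Sum>s\<in>idx k. \<Sum>t\<in>idx k. (cmod (entry a s t))\<^sup>2)"
  define n where "n = real CARD('n)"
  have A: "A \<ge> 0" unfolding A_def by (intro sum_nonneg) auto
  have row: "(\<Sum>g\<in>nb k f. (cmod (entry a f g))\<^sup>2) \<le> A" for f
  proof -
    have "(\<Sum>g\<in>nb k f. (cmod (entry a f g))\<^sup>2) = (\<Sum>g\<in>nb k f. (cmod (entry a (cutoff k f) (cutoff k g)))\<^sup>2)"
      by (rule sum.cong[OF refl]) (simp add: nb_def entry_cut[OF k, of f])
    also have "\<dots> = (\<Sum>t\<in>idx k. (cmod (entry a (cutoff k f) t))\<^sup>2)"
      by (rule sum.reindex_bij_betw[OF bij_cut_nb])
    also have "\<dots> \<le> A" unfolding A_def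
    proof (rule member_le_sum[of "cutoff k f" "idx k" "\<lambda>s. \<Sum>t\<in>idx k. (cmod (entry a s t))\<^sup>2"])
      show "cutoff k f \<in> idx k" by (rule cutoff_in_idx)
    qed (simp_all add: sum_nonneg)
    finally show ?thesis .
  qed
  have pt: "(cmod (entry (a * X) p q))\<^sup>2 \<le> A * (\<Sum>g\<in>nb k p. (cmod (entry X g q))\<^sup>2)" for X p q
  proof -
    have "cmod (entry (a * X) p q) \<le> (\<Sum>g\<in>nb k p. cmod (entry a p g) * cmod (entry X g q))"
      unfolding entry_mult_nb[OF k] by (rule order_trans[OF norm_sum]) (simp add: norm_mult)
    then have "(cmod (entry (a * X) p q))\<^sup>2 \<le> (\<Sum>g\<in>nb k p. cmod (entry a p g) * cmod (entry X g q))\<^sup>2"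
      by (rule power_mono) simp
    also have "\<dots> \<le> (\<Sum>g\<in>nb k p. (cmod (entry a p g))\<^sup>2) * (\<Sum>g\<in>nb k p. (cmod (entry X g q))\<^sup>2)"
      by (rule Cauchy_Schwarz_ineq_sum)
    also have "\<dots> \<le> A * (\<Sum>g\<in>nb k p. (cmod (entry X g q))\<^sup>2)"
      by (rule mult_right_mono[OF row]) (auto intro: sum_nonneg)
    finally show ?thesis .
  qed
  have bd: "(a * X) \<bullet> (a * X) \<le> A * n ^ k * (X \<bullet> X)" for X
  proof -
    obtain l0 where l0: "level l0 X" using level_exists by blast
    define l where "l = max k l0"
    have l: "level l a" "level l X" "k \<le> l" using level_mono[OF l0] level_mono[OF k] by (auto simp: l_def)
    have nbl: "nb k p \<subseteq> idx l" if "p \<in> idx l" for p :: "nat \<Rightarrow> 'n"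
      using that l(3) by (auto simp: nb_def agree_def PiE_iff extensional_def)
    have mask: "(\<Sum>g\<in>idx l. if g \<in> nb k p then F g else 0) = (\<Sum>g\<in>nb k p. F g)"
      if "p \<in> idx l" for p :: "nat \<Rightarrow> 'n" and F :: "_ \<Rightarrow> real"
      using sum.inter_restrict[of "idx l" F "nb k p"] nbl[OF that] by (simp add: Int_absorb1)
    have col: "(\<Sum>p\<in>idx l. (cmod (entry (a * X) p q))\<^sup>2) \<le> A * n ^ k * (\<Sum>r\<in>idx l. (cmod (entry X r q))\<^sup>2)" for q
    proof -
      have "(\<Sum>p\<in>idx l. (cmod (entry (a * X) p q))\<^sup>2)
          \<le> (\<Sum>p\<in>idx l. A * (\<Sum>g\<in>nb k p. (cmod (entry X g q))\<^sup>2))"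
        by (rule sum_mono) (rule pt)
      also have "\<dots> = A * (\<Sum>p\<in>idx l. \<Sum>g\<in>idx l. if g \<in> nb k p then (cmod (entry X g q))\<^sup>2 else 0)"
        by (simp add: sum_distrib_left[symmetric] mask)
      also have "\<dots> = A * (\<Sum>g\<in>idx l. \<Sum>p\<in>idx l. if p \<in> nb k g then (cmod (entry X g q))\<^sup>2 else 0)"
        by (subst sum.swap) (simp add: nb_def agree_sym)
      also have "\<dots> = A * (\<Sum>g\<in>idx l. n ^ k * (cmod (entry X g q))\<^sup>2)"
        by (simp add: mask card_nb n_def)
      finally show ?thesis by (simp add: sum_distrib_left mult.assoc)
    qed
    have "(\<Sum>q\<in>idx l. \<Sum>p\<in>idx l. (cmod (entry (a * X) p q))\<^sup>2)
        \<le> (\<Sum>q\<in>idx l. A * n ^ k * (\<Sum>r\<in>idx l. (cmod (entry X r q))\<^sup>2))"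
      by (rule sum_mono) (rule col)
    then show ?thesis
      unfolding inner_tower_self[OF level_ops(2)[OF l(1,2)]] inner_tower_self[OF l(2)]
      by (simp add: sum_distrib_left[symmetric] divide_right_mono)
  qed
  show ?thesis
  proof (rule bounded_linear_intro[where K = "sqrt (A * n ^ k)"])
    show "a * (X + Y) = a * X + a * Y" for X Y by (rule distrib_left)
    show "a * (r *\<^sub>R X) = r *\<^sub>R (a * X)" for r X by (simp add: scaleR_tower_def mult_scaleC_right)
    show "norm (a * X) \<le> norm X * sqrt (A * n ^ k)" for X
      unfolding norm_tower_def using real_sqrt_le_mono[OF bd[of X]] by (simp add: real_sqrt_mult mult_ac)
  qed
qed

text \<open>
  \<open>tower_alg m\<close> is $A_m$: for \<open>m = 2 * k\<close> it is $M_n^{\otimes (k+1)}$, and for \<open>m = 2 * k + 1\<close> it is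
  $\Delta_n \otimes M_n^{\otimes (k+1)}$, whose elements are diagonal at position \<open>k + 1\<close>.
\<close>

definition tower_alg :: "nat \<Rightarrow> 'n::finite tower set" where
  "tower_alg m = (if even m then {X. level (m div 2 + 1) X}
     else {X. level (m div 2 + 2) X \<and> (\<forall>f g. f (m div 2 + 1) \<noteq> g (m div 2 + 1) \<longrightarrow> entry X f g = 0)})"

text \<open>
  \<open>site k m\<close> is the elementary tensor with \<open>m\<close> at position \<open>k\<close> and $I_n$ at all other positions.
\<close>

lift_definition site :: "nat \<Rightarrow> complex ^ 'n ^ 'n \<Rightarrow> 'n::finite tower"
  is "\<lambda>k m f g. if \<forall>j. j \<noteq> k \<longrightarrow> f j = g j then m $ f k $ g k else 0"
proof -
  fix k and m :: "complex ^ 'n ^ 'n"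
  have "in_level (Suc k) (\<lambda>f g. if \<forall>j. j \<noteq> k \<longrightarrow> f j = g j then m $ f k $ g k else 0)"
    unfolding in_level_def agree_def
    by (auto simp: restrict_def) (metis not_less_eq_eq not_le_imp_less less_Suc_eq)
  then show "\<exists>l. in_level l (\<lambda>f g. if \<forall>j. j \<noteq> k \<longrightarrow> f j = g j then m $ f k $ g k else 0)" by blast
qed

definition matrix_unit :: "'n::finite \<Rightarrow> 'n \<Rightarrow> complex ^ 'n ^ 'n" where
  "matrix_unit i j = (\<chi> a b. if a = i \<and> b = j then 1 else 0)"

definition avg_matrix :: "complex ^ 'n::finite ^ 'n" where
  "avg_matrix = (1 / real CARD('n)) *\<^sub>R (\<Sum>i\<in>UNIV. \<Sum>j\<in>UNIV. matrix_unit i j)"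

definition conj_transpose :: "complex ^ 'n::finite ^ 'n \<Rightarrow> complex ^ 'n ^ 'n" where
  "conj_transpose m = (\<chi> i j. cnj (m $ j $ i))"

definition diag_matrices :: "(complex ^ 'n::finite ^ 'n) set" where
  "diag_matrices = {d. \<forall>i j. i \<noteq> j \<longrightarrow> d $ i $ j = 0}"

text \<open>
  $e_{2k} = J_n \otimes I_n^{\otimes k}$ for $k \ge 1$, and
  $e_{2k+1} = \sum_i E_{ii} \otimes E_{ii} \otimes I_n^{\otimes k}$ for $k \ge 0$; the value at 0 is never used.
\<close>

definition jones_proj :: "nat \<Rightarrow> 'n::finite tower" where
  "jones_proj m = (if even m then site (m div 2) avg_matrix
     else \<Sum>i\<in>UNIV. site (m div 2 + 1) (matrix_unit i i) * site (m div 2) (matrix_unit i i))"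

text \<open>
  \<open>gns_scaleC c\<close> is multiplication of vectors by the complex number \<open>c\<close>. An operator on the complex
  Hilbert space \<open>'n gns\<close> is a bounded real linear one that commutes with all of these.
\<close>

type_synonym 'n gns = "'n tower hcompletion"

definition lmult :: "'n::finite tower \<Rightarrow> 'n gns \<Rightarrow>\<^sub>L 'n gns" where
  "lmult a = hextend (Blinfun (\<lambda>X. a * X))"

definition gns_scaleC :: "complex \<Rightarrow> 'n::finite gns \<Rightarrow>\<^sub>L 'n gns" where
  "gns_scaleC c = hextend (Blinfun (scaleC c))"

definition op_scaleC :: "complex \<Rightarrow> ('n::finite gns \<Rightarrow>\<^sub>L 'n gns) \<Rightarrow> 'n gns \<Rightarrow>\<^sub>L 'n gns" where
  "op_scaleC c T = gns_scaleC c o\<^sub>L T"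

lemma hextend_eqI:
  assumes "\<And>x. blinfun_apply S (hembed x) = blinfun_apply T (hembed x)"
  shows "S = T"
proof (rule blinfun_eqI)
  fix \<xi> :: "'a hcompletion"
  obtain x where x: "cauchy_equiv x x" "\<xi> = abs_hcompletion x"
    by (metis Quotient3_abs_rep Quotient3_hcompletion Quotient3_rep_reflp)
  have l: "(\<lambda>n. hembed (x n)) \<longlonglongrightarrow> \<xi>"
    unfolding x(2) by (rule abs_hcompletion_tendsto) (use x in \<open>simp add: cauchy_equiv_def\<close>)
  have "(\<lambda>n. S (hembed (x n))) \<longlonglongrightarrow> S \<xi>" "(\<lambda>n. T (hembed (x n))) \<longlonglongrightarrow> T \<xi>"
    by (rule bounded_linear.tendsto[OF blinfun.bounded_linear_right l])+
  then show "S \<xi> = T \<xi>" unfolding assms by (rule LIMSEQ_unique)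
qed

lemma lmult_hembed: "blinfun_apply (lmult a) (hembed X) = hembed (a * X)"
  by (simp add: lmult_def hextend_apply hextend_fun_hembed bounded_linear_Blinfun_apply bounded_linear_mult)

lemma gns_scaleC_hembed: "blinfun_apply (gns_scaleC c) (hembed X) = hembed (scaleC c X)"
  by (simp add: gns_scaleC_def hextend_apply hextend_fun_hembed bounded_linear_Blinfun_apply bounded_linear_scaleC)

lemma gns_scaleC_simps:
  "gns_scaleC (a + b) = gns_scaleC a + gns_scaleC b"
  "gns_scaleC (a * b) = gns_scaleC a o\<^sub>L gns_scaleC b"
  "gns_scaleC 1 = id_blinfun"
  "gns_scaleC (complex_of_real r) = r *\<^sub>R id_blinfun"
proof -
  have "scaleC (a + b) X = scaleC a X + scaleC b X" "scaleC (a * b) X = scaleC a (scaleC b X)" "scaleC 1 X = X" for X :: "'x::finite tower"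
    by (transfer, simp add: algebra_simps)+
  note s = this
  show "gns_scaleC (a + b) = gns_scaleC a + gns_scaleC b"
    "gns_scaleC (a * b) = gns_scaleC a o\<^sub>L gns_scaleC b"
    "gns_scaleC 1 = id_blinfun"
    "gns_scaleC (complex_of_real r) = r *\<^sub>R id_blinfun"
    by (rule hextend_eqI, simp add: gns_scaleC_hembed s hembed_add blinfun.add_left blinfun.scaleR_left
      flip: scaleR_tower_def hembed_scaleR)+
qed

interpretation op: vector_space op_scaleC
proof
  fix a b :: complex and S T :: "'a gns \<Rightarrow>\<^sub>L 'a gns"
  show "op_scaleC a (S + T) = op_scaleC a S + op_scaleC a T"
    unfolding op_scaleC_def by (rule blinfun_eqI) (simp add: blinfun.add_left blinfun.add_right)
  show "op_scaleC (a + b) S = op_scaleC a S + op_scaleC b S"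
    unfolding op_scaleC_def by (rule blinfun_eqI) (simp add: blinfun.add_left gns_scaleC_simps)
  show "op_scaleC a (op_scaleC b S) = op_scaleC (a * b) S"
    unfolding op_scaleC_def by (rule blinfun_eqI) (simp add: gns_scaleC_simps)
  show "op_scaleC 1 S = S"
    unfolding op_scaleC_def by (rule blinfun_eqI) (simp add: gns_scaleC_simps)
qed

text \<open>
  Unital von Neumann algebras on the GNS space, as unital $*$-algebras of complex linear operators
  closed in the strong operator topology. Closures taken among the real linear operators are the
  usual ones, as the complex linear operators form a strongly closed set.
\<close>

definition von_neumann_algebra :: "('n::finite gns \<Rightarrow>\<^sub>L 'n gns) set \<Rightarrow> bool" where
  "von_neumann_algebra N \<longleftrightarrow>
     (\<forall>T\<in>N. \<forall>c. T o\<^sub>L gns_scaleC c = gns_scaleC c o\<^sub>L T) \<and>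
     id_blinfun \<in> N \<and> op.subspace N \<and>
     (\<forall>S\<in>N. \<forall>T\<in>N. S o\<^sub>L T \<in> N) \<and>
     (\<forall>T\<in>N. \<exists>T'\<in>N. \<forall>\<xi> \<eta>. blinfun_apply T \<xi> \<bullet> \<eta> = \<xi> \<bullet> blinfun_apply T' \<eta>) \<and>
     closedin strong_operator_topology N"

definition vN_generated :: "('n::finite gns \<Rightarrow>\<^sub>L 'n gns) set \<Rightarrow> ('n gns \<Rightarrow>\<^sub>L 'n gns) set" where
  "vN_generated S = \<Inter>{N. von_neumann_algebra N \<and> S \<subseteq> N}"

definition hyperfinite_R :: "('n::finite gns \<Rightarrow>\<^sub>L 'n gns) set" where
  "hyperfinite_R = strong_operator_topology closure_of (lmult ` (\<Union>m. tower_alg m))"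

definition spin_model :: "complex ^ 'n::finite ^ 'n \<Rightarrow> ('n gns \<Rightarrow>\<^sub>L 'n gns) set" where
  "spin_model u = vN_generated (lmult `
     ({site 0 (u ** d ** conj_transpose u) | d. d \<in> diag_matrices} \<union> {jones_proj j | j. j \<ge> 1}))"

definition product_span :: "('n::finite gns \<Rightarrow>\<^sub>L 'n gns) set \<Rightarrow> ('n gns \<Rightarrow>\<^sub>L 'n gns) set
    \<Rightarrow> ('n gns \<Rightarrow>\<^sub>L 'n gns) set" where
  "product_span P Q = op.span {x o\<^sub>L y | x y. x \<in> P \<and> y \<in> Q}"

text \<open>
  Non-degeneracy of a quadruple of von Neumann algebras $(N \subset P, Q \subset M)$.
\<close>

definition nondegenerate_quadruple ::
  "('n::finite gns \<Rightarrow>\<^sub>L 'n gns) set \<Rightarrow> ('n gns \<Rightarrow>\<^sub>L 'n gns) set \<Rightarrow> ('n gns \<Rightarrow>\<^sub>L 'n gns) set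
    \<Rightarrow> ('n gns \<Rightarrow>\<^sub>L 'n gns) set \<Rightarrow> bool" where
  "nondegenerate_quadruple N P Q M \<longleftrightarrow>
     (\<forall>A\<in>{N, P, Q, M}. von_neumann_algebra A) \<and> N \<subseteq> P \<and> N \<subseteq> Q \<and> P \<subseteq> M \<and> Q \<subseteq> M \<and>
     strong_operator_topology closure_of product_span P Q = M \<and>
     strong_operator_topology closure_of product_span Q P = M"

end

theory Submission
  imports Defs
begin

text \<open>
  Write $\sigma_\theta$ for the self-adjoint unitary with zero diagonal and off-diagonal entries
  $e^{-i\theta}$ and $e^{i\theta}$. Then $u \Delta_2 u^*$ is the span of $I$ and $\sigma_\alpha$, and
  $v \Delta_2 v^*$ is the span of $I$ and $\sigma_\beta$. The product $\sigma_\alpha \sigma_\beta$ is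
  diagonal with entries $e^{\pm i(\beta-\alpha)}$, and $\sin(\beta-\alpha) \neq 0$ says that $I$,
  $\sigma_\alpha$, $\sigma_\beta$, $\sigma_\alpha\sigma_\beta$ are a basis of $M_2$
  (\<open>phase_matrix_products_span\<close>). So every matrix in the first tensor position already lies in the
  span of $R_u R_v$.

  Let $C$ be a unital algebra that contains all Jones projections, for instance the elements of the
  tower in $R_v$. The Jones projections other than $e_1$ commute with the first tensor position, and
  passing $e_1$ across an off-diagonal $2 \times 2$ matrix turns it into $1 - e_1$. Hence $M_2 C$ is
  a left module under $M_2$ and all Jones projections. Since these generate the whole tower
  (\<open>tower_induct_jones\<close>), $M_2 C$ is the whole tower (\<open>site0_module_UNIV\<close>), and
  $R_u R_v$ contains a strongly dense subset of $R$. Exchanging $u$ and $v$ gives the same for $R_v R_u$.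

  The analytic part is that the objects involved are von Neumann algebras. The essential point is that
  the strong closure of the left multiplications is closed under adjoints. This follows from
  identifying it with the commutant of the right multiplications: if $T$ commutes with these, the
  projections $x_k$ of the vector $T 1$ to the finite levels act as left multiplications of norm at
  most that of $T$ and converge strongly to $T$ (\<open>commutant_approximation\<close>); and as the trace
  makes the involution isometric, the $x_k^*$ converge strongly as well, to the adjoint of $T$
  (\<open>hyperfinite_R_adjoint\<close>).
\<close>

section \<open>Generators of the tower\<close>

lemma tower_ext: "(\<And>f g. entry X f g = entry Y f g) \<Longrightarrow> X = Y"
  by transfer blast

lemma entry_one: "entry 1 f g = (if f = g then 1 else 0)"
  by transfer simp

definition eq_off :: "nat \<Rightarrow> (nat \<Rightarrow> 'n) \<Rightarrow> (nat \<Rightarrow> 'n) \<Rightarrow> bool" where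
  "eq_off k f g \<longleftrightarrow> (\<forall>j. j \<noteq> k \<longrightarrow> f j = g j)"

lemma eq_off_upd [simp]: "eq_off k (f(k := a)) g \<longleftrightarrow> eq_off k f g"
  by (auto simp: eq_off_def)

lemma eq_iff_eq_off: "f = g \<longleftrightarrow> eq_off k f g \<and> f k = g k"
  by (auto simp: eq_off_def fun_eq_iff)

lemma entry_site: "entry (site k m) f g = (if eq_off k f g then m $ f k $ g k else 0)"
  unfolding eq_off_def by transfer simp

lemma entry_sum: "entry (sum F I) f g = (\<Sum>i\<in>I. entry (F i) f g)"
  by (induction I rule: infinite_finite_induct) (auto simp: entry_ops)

lemma entry_diff: "entry (X - Y) f g = entry X f g - entry Y f g"
  unfolding minus_tower_def by transfer simp

text \<open>
  The product sums over the columns where the left factor does not vanish; any finite set that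
  contains them gives the same value, which makes the sum explicit for elementary tensors and
  diagonal elements.
\<close>

lemma entry_mult_support:
  assumes "finite G" "\<And>g. g \<notin> G \<Longrightarrow> entry X f g = 0"
  shows "entry (X * Y) f h = (\<Sum>g\<in>G. entry X f g * entry Y g h)"
proof -
  have "entry (X * Y) f h = mmul (entry X) (entry Y) f h" by transfer simp
  also have "\<dots> = (\<Sum>g\<in>G. entry X f g * entry Y g h)"
    unfolding mmul_def by (rule sum.mono_neutral_left) (use assms in auto)
  finally show ?thesis .
qed

lemma entry_site_mult:
  "entry (site k m * Y) f h = (\<Sum>a\<in>UNIV. m $ f k $ a * entry Y (f(k := a)) h)"
proof -
  have inj: "inj (\<lambda>a. f(k := a))" by (rule injI) (metis fun_upd_same)
  have "entry (site k m * Y) f h = (\<Sum>g\<in>range (\<lambda>a. f(k := a)). entry (site k m) f g * entry Y g h)"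
  proof (rule entry_mult_support)
    fix g assume g: "g \<notin> range (\<lambda>a. f(k := a))"
    have "g = f(k := g k)" if "eq_off k f g" using that by (auto simp: eq_off_def)
    with g show "entry (site k m) f g = 0" by (auto simp: entry_site)
  qed simp
  also have "\<dots> = (\<Sum>a\<in>UNIV. m $ f k $ a * entry Y (f(k := a)) h)"
    by (simp add: sum.reindex[OF inj] entry_site) (simp add: eq_off_def)
  finally show ?thesis .
qed

lemma site_mult: "site k m * site k m' = site k (m ** m')"
proof (rule tower_ext)
  fix f h
  show "entry (site k m * site k m') f h = entry (site k (m ** m')) f h"
    by (auto simp: entry_site_mult entry_site matrix_matrix_mult_def)
qed

lemma site_add: "site k (m + m') = site k m + site k m'"
  by (rule tower_ext) (simp add: entry_ops entry_site)

lemma site_zero: "site k 0 = 0"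
  by (rule tower_ext) (simp add: entry_ops entry_site)

lemma site_mat: "site k (mat c) = scaleC c 1"
  by (rule tower_ext) (auto simp: entry_ops entry_one entry_site mat_def eq_iff_eq_off[of _ _ k])

lemma site_commute:
  assumes "j \<noteq> k"
  shows "site j m * site k m' = site k m' * site j m"
proof (rule tower_ext)
  have *: "entry (site j m * site k m') f h
    = (if \<forall>i. i \<noteq> j \<and> i \<noteq> k \<longrightarrow> f i = h i then m $ f j $ h j * m' $ f k $ h k else 0)"
    if "j \<noteq> k" for j k f h and m m' :: "complex ^ 'a ^ 'a"
  proof -
    have "entry (site j m * site k m') f h
        = (\<Sum>a\<in>UNIV. if a = h j then m $ f j $ a * entry (site k m') (f(j := a)) h else 0)"
      unfolding entry_site_mult by (rule sum.cong) (use that in \<open>auto simp: entry_site eq_off_def\<close>)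
    also have "\<dots> = m $ f j $ h j * entry (site k m') (f(j := h j)) h" by simp
    also have "\<dots> = (if \<forall>i. i \<noteq> j \<and> i \<noteq> k \<longrightarrow> f i = h i then m $ f j $ h j * m' $ f k $ h k else 0)"
      using that by (auto simp: entry_site eq_off_def)
    finally show ?thesis .
  qed
  fix f h
  show "entry (site j m * site k m') f h = entry (site k m' * site j m) f h"
    unfolding *[OF assms] *[OF assms[symmetric]] by (auto simp: mult.commute)
qed

lemma scaleC_as_site: "scaleC c X = site 0 (mat c) * X"
  by (rule tower_ext) (simp add: entry_site_mult mat_def entry_ops if_distrib if_distribR cong: if_cong)

lemma matrix_entries:
  fixes m :: "complex ^ 'n::finite ^ 'n"
  shows "(mat c ** m) $ i $ j = c * m $ i $ j"
    "(matrix_unit a b ** m) $ i $ j = (if i = a then m $ b $ j else 0)"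
    "(m ** matrix_unit a b) $ i $ j = (if j = b then m $ i $ a else 0)"
    "(avg_matrix :: complex ^ 'n ^ 'n) $ i $ j = 1 / of_nat CARD('n)"
proof -
  show "(mat c ** m) $ i $ j = c * m $ i $ j"
    by (simp add: matrix_matrix_mult_def mat_def if_distrib if_distribR cong: if_cong)
  have "(matrix_unit a b ** m) $ i $ j = (\<Sum>l\<in>UNIV. if l = b then (if i = a then m $ l $ j else 0) else 0)"
    unfolding matrix_matrix_mult_def vec_lambda_beta by (intro sum.cong refl) (auto simp: matrix_unit_def)
  then show "(matrix_unit a b ** m) $ i $ j = (if i = a then m $ b $ j else 0)" by simp
  have "(m ** matrix_unit a b) $ i $ j = (\<Sum>l\<in>UNIV. if l = a then (if j = b then m $ i $ l else 0) else 0)"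
    unfolding matrix_matrix_mult_def vec_lambda_beta by (intro sum.cong refl) (auto simp: matrix_unit_def)
  then show "(m ** matrix_unit a b) $ i $ j = (if j = b then m $ i $ a else 0)" by simp
  have "(\<Sum>a\<in>UNIV. \<Sum>b\<in>UNIV. matrix_unit a b :: complex ^ 'n ^ 'n) $ i $ j
      = (\<Sum>a\<in>UNIV. \<Sum>b\<in>UNIV. if a = i then if b = j then 1 else 0 else 0)"
    unfolding sum_component by (intro sum.cong refl) (auto simp: matrix_unit_def)
  also have "\<dots> = 1" by (subst sum.swap) simp
  finally show "(avg_matrix :: complex ^ 'n ^ 'n) $ i $ j = 1 / of_nat CARD('n)"
    unfolding avg_matrix_def vector_scaleR_component by (simp add: scaleR_conv_of_real)
qed

lemma matrix_unit_expansion: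
  "(m :: complex ^ 'n::finite ^ 'n) = (\<Sum>a\<in>UNIV. \<Sum>b\<in>UNIV. mat (m $ a $ b) ** matrix_unit a b)"
proof -
  have "(\<Sum>a\<in>UNIV. \<Sum>b\<in>UNIV. mat (m $ a $ b) ** matrix_unit a b) $ i $ j
      = (\<Sum>a\<in>UNIV. \<Sum>b\<in>UNIV. if b = j then if a = i then m $ i $ j else 0 else 0)" for i j
    unfolding sum_component matrix_entries(1) by (intro sum.cong refl) (auto simp: matrix_unit_def)
  then show ?thesis by (simp add: vec_eq_iff)
qed

lemma level_0: fixes X :: "'a::finite tower" shows "level 0 X \<Longrightarrow> \<exists>c. X = scaleC c 1"
proof
  assume X: "level 0 X"
  let ?u = "\<lambda>_. undefined"
  show "X = scaleC (entry X ?u ?u) 1"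
  proof (rule tower_ext)
    fix f g :: "nat \<Rightarrow> 'a"
    have "agree 0 f g \<longleftrightarrow> f = g" by (auto simp: agree_def)
    moreover have "cutoff 0 f = ?u" "cutoff 0 g = ?u" by auto
    moreover have "\<not> agree 0 f g \<Longrightarrow> entry X f g = 0" using X by transfer (rule in_levelD)
    ultimately show "entry X f g = entry (scaleC (entry X ?u ?u) 1) f g"
      using entry_cut[OF X, of f g] by (cases "f = g") (simp_all add: entry_ops entry_one)
  qed
qed

lemma in_level_corner:
  "in_level k (\<lambda>f g. if agree k f g then X ((cutoff k f)(k := a)) ((cutoff k g)(k := b)) else 0)"
  unfolding in_level_def by simp

text \<open>
  Splitting off the highest tensor factor of an element of level \<open>k + 1\<close> writes it as a block matrix
  whose blocks have level \<open>k\<close>. Reading the block at \<open>(a, b)\<close> means prescribing the values \<open>a\<close> and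
  \<open>b\<close> at position \<open>k\<close> of the row and column index.
\<close>

lift_definition corner :: "nat \<Rightarrow> 'n \<Rightarrow> 'n \<Rightarrow> 'n::finite tower \<Rightarrow> 'n tower"
  is "\<lambda>k a b X f g. if agree k f g then X ((cutoff k f)(k := a)) ((cutoff k g)(k := b)) else 0"
  by (rule exI, rule in_level_corner)

lemma level_corner: "level k (corner k a b X)"
  by transfer (rule in_level_corner)

lemma corner_expansion:
  assumes X: "level (Suc k) X"
  shows "X = (\<Sum>a\<in>UNIV. \<Sum>b\<in>UNIV. site k (matrix_unit a b) * corner k a b X)"
proof (rule tower_ext)
  fix f h
  have z: "\<not> agree (Suc k) f h \<Longrightarrow> entry X f h = 0" using X by transfer (rule in_levelD)
  have ag: "agree k (f(k := h k)) h \<longleftrightarrow> agree (Suc k) f h"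
    unfolding agree_def by (metis Suc_leD Suc_leI fun_upd_apply le_neq_implies_less not_less_eq_eq order_refl)
  have cut: "(cutoff k g)(k := g k) = cutoff (Suc k) g" for g :: "nat \<Rightarrow> 'a" by (auto simp: fun_eq_iff)
  have cf: "cutoff k (f(k := c)) = cutoff k f" for c by (auto simp: fun_eq_iff)
  have ce: "entry (corner k a b X) f g = (if agree k f g then entry X ((cutoff k f)(k := a)) ((cutoff k g)(k := b)) else 0)"
    for a b f g by transfer simp
  have na: "\<not> agree k (f(k := b)) h" if "b \<noteq> h k" for b using that by (auto simp: agree_def)
  have "entry (\<Sum>a\<in>UNIV. \<Sum>b\<in>UNIV. site k (matrix_unit a b) * corner k a b X) f h
     = (\<Sum>a\<in>UNIV. \<Sum>b\<in>UNIV. if a = f k then entry (corner k a b X) (f(k := b)) h else 0)"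
    unfolding entry_sum entry_site_mult
    by (intro sum.cong refl) (simp add: matrix_unit_def if_distrib if_distribR cong: if_cong)
  also have "\<dots> = (\<Sum>b\<in>UNIV. entry (corner k (f k) b X) (f(k := b)) h)"
    by (subst sum.swap) simp
  also have "\<dots> = (\<Sum>b\<in>UNIV. if b = h k then entry (corner k (f k) b X) (f(k := b)) h else 0)"
    by (rule sum.cong) (use na in \<open>auto simp: ce\<close>)
  also have "\<dots> = entry (corner k (f k) (h k) X) (f(k := h k)) h" by simp
  also have "\<dots> = entry X f h"
    using z entry_cut[OF X, of f h] by (simp add: ce cf cut ag)
  finally show "entry X f h = entry (\<Sum>a\<in>UNIV. \<Sum>b\<in>UNIV. site k (matrix_unit a b) * corner k a b X) f h" ..
qed

text \<open>
  The elementary tensors generate the tower as a ring, by induction on the level through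
  \<open>corner_expansion\<close>. Scalars occur among the generators, as \<open>site k (mat c)\<close>.
\<close>

lemma tower_induct_sites:
  assumes add: "\<And>X Y. P X \<Longrightarrow> P Y \<Longrightarrow> P (X + Y)"
    and mult: "\<And>X Y. P X \<Longrightarrow> P Y \<Longrightarrow> P (X * Y)"
    and site: "\<And>k m. P (site k m)"
  shows "P X"
proof -
  have zero: "P 0" using site[of 0 0] by (simp add: site_zero)
  have sum: "finite I \<Longrightarrow> (\<And>i. i \<in> I \<Longrightarrow> P (F i)) \<Longrightarrow> P (sum F I)" for F :: "'b \<Rightarrow> 'a tower" and I
    by (induction I rule: finite_induct) (simp_all add: add zero)
  have "level k X \<Longrightarrow> P X" for k X
  proof (induction k arbitrary: X)
    case 0
    then show ?case using level_0[OF 0] site[of 0 "mat _"] by (auto simp: site_mat)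
  next
    case (Suc k)
    show ?case
      by (subst corner_expansion[OF Suc.prems]) (intro sum finite mult site Suc.IH level_corner)
  qed
  then show ?thesis using level_exists by blast
qed

lemma jones_proj_even: "jones_proj (2 * k) = site k avg_matrix"
  by (simp add: jones_proj_def)

lemma entry_mult_diagonal:
  assumes "\<forall>f g. f \<noteq> g \<longrightarrow> entry D f g = 0"
  shows "entry (D * Y) f h = entry D f f * entry Y f h" "entry (Y * D) f h = entry Y f h * entry D h h"
proof -
  show "entry (D * Y) f h = entry D f f * entry Y f h"
    using entry_mult_support[of "{f}" D f Y h] assms by auto
  obtain k where k: "level k Y" using level_exists by blast
  have "entry (Y * D) f h = (\<Sum>g\<in>nb k f. entry Y f g * entry D g h)" by (rule entry_mult_nb[OF k])
  also have "\<dots> = (\<Sum>g\<in>nb k f. if g = h then entry Y f h * entry D h h else 0)"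
    by (rule sum.cong) (use assms in auto)
  also have "\<dots> = entry Y f h * entry D h h"
  proof (cases "h \<in> nb k f")
    case False
    then have "\<not> agree k f h" by (simp add: nb_def)
    then have "entry Y f h = 0" using k by transfer (rule in_levelD)
    then show ?thesis by (simp add: sum.delta)
  qed (simp add: sum.delta)
  finally show "entry (Y * D) f h = entry Y f h * entry D h h" .
qed

lemma entry_jones_proj_odd:
  "entry (jones_proj (Suc (2 * k))) f g = (if f = g \<and> f k = f (Suc k) then 1 else 0)"
proof -
  have e: "entry (site j (matrix_unit i i)) f g = (if f = g \<and> f j = i then 1 else 0)" for i :: 'a and j f g
  proof -
    show ?thesis by (auto simp: entry_site matrix_unit_def eq_iff_eq_off[of f g j])
  qed
  have summand: "entry (site (Suc k) (matrix_unit i i) * site k (matrix_unit i i)) f g = (if f = g \<and> f k = i \<and> f (Suc k) = i then 1 else 0)" for i :: 'a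
    by (subst entry_mult_diagonal(1)) (auto simp: e)
  have "entry (jones_proj (Suc (2 * k))) f g
      = (\<Sum>i\<in>UNIV. entry (site (Suc k) (matrix_unit i i) * site k (matrix_unit i i)) f g)"
    by (simp add: jones_proj_def entry_sum)
  also have "\<dots> = (\<Sum>i\<in>UNIV. if f k = i then if f = g \<and> f (Suc k) = i then 1 else 0 else 0)"
    by (intro sum.cong refl) (auto simp: summand)
  also have "\<dots> = (if f = g \<and> f k = f (Suc k) then 1 else 0)"
    by (subst sum.delta') auto
  finally show ?thesis .
qed

text \<open>
  The odd Jones projection is the indicator of equal values at the positions \<open>k\<close> and \<open>k + 1\<close>.
  Cutting it down by a minimal diagonal projection at position \<open>k\<close> therefore creates the same
  projection at position \<open>k + 1\<close>, and summing over the conjugates by matrix units removes the factor at position \<open>k\<close>.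
\<close>

lemma jones_proj_odd_compress:
  "(\<Sum>j\<in>UNIV. site k (matrix_unit j i) * (jones_proj (Suc (2 * k)) * site k (matrix_unit i j)))
    = site (Suc k) (matrix_unit i i)"
proof (rule tower_ext)
  fix f h :: "nat \<Rightarrow> 'a"
  have "entry (site k (matrix_unit j i) * (jones_proj (Suc (2 * k)) * site k (matrix_unit i j))) f h
     = (if f k = j then entry (site (Suc k) (matrix_unit i i)) f h else 0)" for j
  proof -
    have "entry (site k (matrix_unit j i) * (jones_proj (Suc (2 * k)) * site k (matrix_unit i j))) f h
       = (\<Sum>a\<in>UNIV. if a = i then if f k = j then
            entry (jones_proj (Suc (2 * k)) * site k (matrix_unit i j)) (f(k := a)) h else 0 else 0)"
      unfolding entry_site_mult by (intro sum.cong refl) (auto simp: matrix_unit_def)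
    also have "\<dots> = (if f k = j then if f (Suc k) = i \<and> eq_off k f h \<and> h k = j then 1 else 0 else 0)"
      by (simp add: entry_mult_diagonal(1) entry_jones_proj_odd entry_site) (auto simp: matrix_unit_def)
    also have "\<dots> = (if f k = j then if f (Suc k) = i \<and> f = h then 1 else 0 else 0)"
      by (auto simp: eq_iff_eq_off[of f h k])
    also have "\<dots> = (if f k = j then entry (site (Suc k) (matrix_unit i i)) f h else 0)"
      by (auto simp: entry_site matrix_unit_def eq_iff_eq_off[of f h "Suc k"])
    finally show ?thesis .
  qed
  then show "entry (\<Sum>j\<in>UNIV. site k (matrix_unit j i) * (jones_proj (Suc (2 * k)) * site k (matrix_unit i j))) f h
     = entry (site (Suc k) (matrix_unit i i)) f h"
    by (simp add: entry_sum)
qed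

text \<open>
  The first tensor factor and the Jones projections generate the tower. If all matrices at position
  \<open>k\<close> are available, the odd projection \<open>2 * k + 1\<close> carries the diagonal matrix units to position
  \<open>k + 1\<close> by \<open>jones_proj_odd_compress\<close>; sandwiching the averaging matrix, which is the next even
  projection, between diagonal units then yields all matrix units there.
\<close>

lemma tower_induct_jones:
  fixes X :: "'n::finite tower"
  assumes add: "\<And>X Y. P X \<Longrightarrow> P Y \<Longrightarrow> P (X + Y)"
    and mult: "\<And>X Y. P X \<Longrightarrow> P Y \<Longrightarrow> P (X * Y)"
    and site0: "\<And>m. P (site 0 m)"
    and jones: "\<And>j. j \<ge> 1 \<Longrightarrow> P (jones_proj j)"
  shows "P X"
proof (rule tower_induct_sites[of P, OF add mult])
  fix k and m :: "complex ^ 'n ^ 'n"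
  have zero: "P 0" using site0[of 0] by (simp add: site_zero)
  have sum: "finite I \<Longrightarrow> (\<And>i. i \<in> I \<Longrightarrow> P (F i)) \<Longrightarrow> P (sum F I)" for F :: "'n \<Rightarrow> 'n tower" and I
    by (induction I rule: finite_induct) (simp_all add: add zero)
  have matc: "P (site k (mat c))" for k c using site0[of "mat c"] by (simp add: site_mat)
  have site_sum: "site k (sum F I) = (\<Sum>i\<in>I. site k (F i))" for k F and I :: "'n set"
    by (rule tower_ext) (auto simp: entry_sum entry_site)
  show "P (site k m)"
  proof (induction k arbitrary: m)
    case (Suc k)
    have d: "P (site (Suc k) (matrix_unit i i))" for i
      by (subst jones_proj_odd_compress[symmetric]) (intro sum finite mult Suc jones, simp)
    have e: "matrix_unit a b = mat (of_nat CARD('n)) ** (matrix_unit a a ** (avg_matrix ** matrix_unit b b))" for a b :: 'n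
      by (simp add: vec_eq_iff matrix_entries) (simp add: matrix_unit_def)
    have "P (site (Suc k) avg_matrix)"
      using jones[of "2 * Suc k"] unfolding jones_proj_even by simp
    then have u: "P (site (Suc k) (matrix_unit a b))" for a b
      by (subst e) (unfold site_mult[symmetric], intro mult d matc)
    show ?case
      by (subst matrix_unit_expansion[of m]) (unfold site_sum site_mult[symmetric], intro sum finite mult u matc)
  qed (rule site0)
qed simp_all

lemma scaleC_mult_left: "scaleC c X * Y = scaleC c (X * Y)"
  unfolding scaleC_as_site by (rule mult.assoc)

lemma scaleC_one: "scaleC 1 X = X"
  by (rule tower_ext) (simp add: entry_ops)

section \<open>The hyperfinite factor as a commutant\<close>

lemma star_star [simp]: "star (star X) = X"
  by transfer simp

lemma star_mult: "star (X * Y) = star Y * star X"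
proof -
  obtain k where k: "level k X" "level k Y"
    using level_exists[of X] level_exists[of Y] by (metis level_mono nat_le_linear)
  note s = level_ops(4)[OF k(1)] level_ops(4)[OF k(2)]
  show ?thesis
    by (rule tower_eqI[OF level_ops(4)[OF level_ops(2)[OF k]] level_ops(2)[OF s(2,1)]])
       (simp add: entry_ops entry_mult_idx[OF k] entry_mult_idx[OF s(2,1)] mult.commute)
qed

lemma inner_star: "star X \<bullet> star Y = X \<bullet> Y"
proof -
  obtain k where k: "level k X" "level k Y"
    using level_exists[of X] level_exists[of Y] by (metis level_mono nat_le_linear)
  show ?thesis
    unfolding inner_tower_level[OF k] inner_tower_level[OF level_ops(4)[OF k(1)] level_ops(4)[OF k(2)]]
    by (subst sum.swap) (simp add: entry_ops)
qed

lemma norm_star: "norm (star X) = norm (X :: 'n::finite tower)"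
  by (simp add: norm_eq_sqrt_inner inner_star)

lemma inner_mult_left: "(a * X) \<bullet> Y = X \<bullet> (star a * Y)"
  by (simp add: inner_tower_def star_mult mult.assoc)

lemma inner_mult_right: "(X * a) \<bullet> Y = X \<bullet> (Y * star a)"
proof -
  have "(X * a) \<bullet> Y = (star a * star X) \<bullet> star Y"
    using inner_star[of "X * a" Y] by (simp add: star_mult)
  also have "\<dots> = star X \<bullet> star (Y * star a)"
    by (simp add: inner_mult_left star_mult)
  finally show ?thesis by (simp only: inner_star)
qed

lemma bounded_linear_mult_right: "bounded_linear (\<lambda>X. X * a)" for a :: "'n::finite tower"
proof -
  obtain K where K: "\<And>X. norm (star a * X) \<le> norm X * K"
    using bounded_linear.bounded[OF bounded_linear_mult[of "star a"]] by blast
  show ?thesis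
  proof (rule bounded_linear_intro[where K = K])
    show "(X + Y) * a = X * a + Y * a" for X Y by (rule distrib_right)
    show "(r *\<^sub>R X) * a = r *\<^sub>R (X * a)" for r X by (simp add: scaleR_tower_def scaleC_mult_left)
    show "norm (X * a) \<le> norm X * K" for X
      using K[of "star X"] norm_star[of "X * a"] norm_star[of X] by (simp add: star_mult)
  qed
qed

lemma blinfun_eq_iff: "S = T \<longleftrightarrow> (\<forall>x. blinfun_apply S x = blinfun_apply T x)"
  by (auto intro: blinfun_eqI)

text \<open>
  Left and right multiplication commute. The right multiplications serve to describe the von Neumann
  algebra generated by the left ones without any closure, namely as their commutant.
\<close>

definition rmult :: "'n::finite tower \<Rightarrow> 'n gns \<Rightarrow>\<^sub>L 'n gns" where
  "rmult a = hextend (Blinfun (\<lambda>X. X * a))"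

lemma rmult_hembed: "blinfun_apply (rmult a) (hembed X) = hembed (X * a)"
  by (simp add: rmult_def hextend_apply hextend_fun_hembed bounded_linear_Blinfun_apply bounded_linear_mult_right)

lemma gns_scaleC_eq_rmult: "gns_scaleC c = rmult (scaleC c 1)"
  by (rule hextend_eqI) (simp add: gns_scaleC_hembed rmult_hembed mult_scaleC_right)

lemma lmult_rmult: "lmult x o\<^sub>L rmult a = rmult a o\<^sub>L lmult x"
  by (rule hextend_eqI) (simp add: lmult_hembed rmult_hembed mult.assoc)

text \<open>
  Closed conditions extend from the dense copy of the tower to the whole completion.
\<close>

lemma hembed_induct:
  assumes "closed {\<xi>. P \<xi>}" "\<And>x. P (hembed x)"
  shows "P \<xi>"
proof -
  have "\<xi> \<in> closure (range hembed)"
    unfolding closure_approachable using hembed_dense[of _ \<xi>] by (auto simp: dist_norm)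
  also have "closure (range hembed) \<subseteq> {\<xi>. P \<xi>}"
    by (rule closure_minimal) (use assms in auto)
  finally show ?thesis by simp
qed

lemma rmult_adjoint: "blinfun_apply (rmult a) \<xi> \<bullet> hembed y = \<xi> \<bullet> hembed (y * star a)"
  by (rule hembed_induct[of _ \<xi>])
     (auto intro!: closed_Collect_eq continuous_intros simp: rmult_hembed inner_hembed inner_mult_right)

lemma lmult_adjoint: "blinfun_apply (lmult a) \<xi> \<bullet> \<eta> = \<xi> \<bullet> blinfun_apply (lmult (star a)) \<eta>"
proof (rule hembed_induct[of _ \<xi>])
  fix x
  show "blinfun_apply (lmult a) (hembed x) \<bullet> \<eta> = hembed x \<bullet> blinfun_apply (lmult (star a)) \<eta>"
    by (rule hembed_induct[of _ \<eta>])
       (auto intro!: closed_Collect_eq continuous_intros simp: lmult_hembed inner_hembed inner_mult_left)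
qed (auto intro!: closed_Collect_eq continuous_intros)

lemma lmult_bound:
  assumes "\<And>a. norm (x * a) \<le> C * norm a"
  shows "norm (blinfun_apply (lmult x) \<xi>) \<le> C * norm \<xi>"
  by (rule hembed_induct[of _ \<xi>])
     (auto intro!: closed_Collect_le continuous_intros simp: lmult_hembed norm_hembed assms)

lift_definition of_block :: "nat \<Rightarrow> ((nat \<Rightarrow> 'n) \<Rightarrow> (nat \<Rightarrow> 'n) \<Rightarrow> complex) \<Rightarrow> 'n::finite tower"
  is "\<lambda>k c f g. if agree k f g then c (cutoff k f) (cutoff k g) else 0"
  subgoal for k c by (rule exI[of _ k]) (simp add: in_level_def)
  done

lemma level_of_block: "level k (of_block k c)"
  by transfer (simp add: in_level_def)

lemma entry_of_block: "p \<in> idx k \<Longrightarrow> q \<in> idx k \<Longrightarrow> entry (of_block k c) p q = c p q"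
  by transfer simp

lemma entry_scaleR: "entry (r *\<^sub>R X) f g = of_real r * entry X f g"
  by (simp add: scaleR_tower_def entry_ops)

lemma level_diff: "level k X \<Longrightarrow> level k Y \<Longrightarrow> level k (X - Y)"
proof -
  assume "level k X" "level k Y"
  moreover have "X - Y = X + scaleC (-1) Y" unfolding minus_tower_def by transfer simp
  ultimately show ?thesis by (simp only: level_ops)
qed

text \<open>
  The matrix units of level \<open>k\<close>. Together with their multiples by \<open>\<i>\<close> they form a real
  basis of the elements of level \<open>k\<close>, orthogonal for the trace inner product.
\<close>

definition block_unit :: "nat \<Rightarrow> (nat \<Rightarrow> 'n) \<Rightarrow> (nat \<Rightarrow> 'n) \<Rightarrow> 'n::finite tower" where
  "block_unit k p q = of_block k (\<lambda>p' q'. if p' = p \<and> q' = q then 1 else 0)"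

lemma level_sum: "(\<And>i. i \<in> I \<Longrightarrow> level k (F i)) \<Longrightarrow> level k (sum F I)"
proof -
  have "level k 0" by transfer (simp add: in_level_def)
  moreover assume "\<And>i. i \<in> I \<Longrightarrow> level k (F i)"
  ultimately show "level k (sum F I)"
    by (induction I rule: infinite_finite_induct) (auto intro: level_ops(1))
qed

lemma block_unit_expansion:
  fixes y :: "'n::finite tower"
  assumes y: "level k y"
  shows "y = (\<Sum>p\<in>idx k. \<Sum>q\<in>idx k. Re (entry y q p) *\<^sub>R block_unit k q p + Im (entry y q p) *\<^sub>R scaleC \<i> (block_unit k q p))"
proof (rule tower_eqI[OF y])
  have lu: "level k (block_unit k q p)" for p q :: "nat \<Rightarrow> 'n" unfolding block_unit_def by (rule level_of_block)
  show "level k (\<Sum>p\<in>idx k. \<Sum>q\<in>idx k. Re (entry y q p) *\<^sub>R block_unit k q p + Im (entry y q p) *\<^sub>R scaleC \<i> (block_unit k q p))"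
    by (intro level_sum level_ops(1)) (auto simp: scaleR_tower_def intro!: level_ops lu)
  fix a b :: "nat \<Rightarrow> 'n" assume ab: "a \<in> idx k" "b \<in> idx k"
  have "entry (\<Sum>p\<in>idx k. \<Sum>q\<in>idx k. Re (entry y q p) *\<^sub>R block_unit k q p + Im (entry y q p) *\<^sub>R scaleC \<i> (block_unit k q p)) a b
     = (\<Sum>p\<in>idx k. \<Sum>q\<in>idx k. if p = b then if q = a then entry y a b else 0 else 0)"
    unfolding entry_sum
    by (intro sum.cong refl) (auto simp: entry_ops entry_scaleR block_unit_def entry_of_block ab complex_eq_iff)
  also have "\<dots> = entry y a b"
    by (subst sum.swap) (simp add: ab)
  finally show "entry y a b = entry (\<Sum>p\<in>idx k. \<Sum>q\<in>idx k. Re (entry y q p) *\<^sub>R block_unit k q p + Im (entry y q p) *\<^sub>R scaleC \<i> (block_unit k q p)) a b" ..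
qed

text \<open>
  The orthogonal projection of the GNS space onto the vectors of level \<open>k\<close>, written in the matrix
  units; it extends the trace preserving conditional expectation onto that matrix algebra. The factor
  $n^k$ undoes the normalization of the trace, and the imaginary coordinate is needed because only the
  real part of the complex inner product is available. Taking the values in the tower and not in the
  completion lets them act by left multiplication.
\<close>

definition cond_exp :: "nat \<Rightarrow> 'n::finite gns \<Rightarrow> 'n tower" where
  "cond_exp k \<xi> = of_block k (\<lambda>p q. of_real (real CARD('n) ^ k) *
     Complex (\<xi> \<bullet> hembed (block_unit k p q)) (\<xi> \<bullet> hembed (scaleC \<i> (block_unit k p q))))"

lemma hembed_sum: "hembed (sum F I) = (\<Sum>i\<in>I. hembed (F i))"
  for F :: "'b \<Rightarrow> 'a::real_inner"
proof -
  have "hembed (0 :: 'a) = 0" using hembed_diff[of "0 :: 'a" 0] by simp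
  then show ?thesis by (induction I rule: infinite_finite_induct) (simp_all add: hembed_add)
qed

lemma level_cond_exp: "level k (cond_exp k \<xi>)"
  unfolding cond_exp_def by (rule level_of_block)

text \<open>
  Together with \<open>level_cond_exp\<close> this determines the value of the conditional expectation, so that
  all further properties follow by comparing inner products with elements of level \<open>k\<close>.
\<close>

lemma cond_exp_inner:
  fixes \<xi> :: "'n::finite gns"
  assumes y: "level k y"
  shows "cond_exp k \<xi> \<bullet> y = \<xi> \<bullet> hembed y"
proof -
  have "\<xi> \<bullet> hembed y = (\<Sum>p\<in>idx k. \<Sum>q\<in>idx k. Re (entry y q p) * (\<xi> \<bullet> hembed (block_unit k q p))
      + Im (entry y q p) * (\<xi> \<bullet> hembed (scaleC \<i> (block_unit k q p))))"
    by (subst block_unit_expansion[OF y])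
       (simp add: hembed_sum hembed_add hembed_scaleR inner_sum_right inner_add_right)
  moreover have "cond_exp k \<xi> \<bullet> y = (\<Sum>p\<in>idx k. \<Sum>q\<in>idx k. Re (entry y q p) * (\<xi> \<bullet> hembed (block_unit k q p))
      + Im (entry y q p) * (\<xi> \<bullet> hembed (scaleC \<i> (block_unit k q p))))"
    unfolding inner_tower_level[OF level_cond_exp y] sum_divide_distrib
    by (intro sum.cong refl) (simp add: cond_exp_def entry_of_block field_simps)
  ultimately show ?thesis by simp
qed

lemma level_inner_eqI:
  assumes "level k x" "level k y" "\<And>z. level k z \<Longrightarrow> x \<bullet> z = y \<bullet> z"
  shows "x = y"
proof -
  have "(x - y) \<bullet> (x - y) = 0"
    using assms(3)[OF level_diff[OF assms(1,2)]] by (simp add: inner_diff_left)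
  then show ?thesis by simp
qed

lemma cond_exp_level: "level k y \<Longrightarrow> cond_exp k (hembed y) = y"
  by (rule level_inner_eqI[OF level_cond_exp]) (simp_all add: cond_exp_inner inner_hembed)

lemma cond_exp_diff: "cond_exp k (\<xi> - \<eta>) = cond_exp k \<xi> - cond_exp k \<eta>"
  by (rule level_inner_eqI[OF level_cond_exp level_diff[OF level_cond_exp level_cond_exp]])
     (simp_all add: cond_exp_inner inner_diff_left)

lemma cond_exp_rmult:
  assumes a: "level k a"
  shows "cond_exp k (blinfun_apply (rmult a) \<xi>) = cond_exp k \<xi> * a"
  by (rule level_inner_eqI[OF level_cond_exp level_ops(2)[OF level_cond_exp a]])
     (simp add: cond_exp_inner inner_mult_right rmult_adjoint level_ops a)

lemma norm_cond_exp: "norm (cond_exp k \<xi>) \<le> norm \<xi>"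
proof (cases "cond_exp k \<xi> = 0")
  case False
  have "norm (cond_exp k \<xi>) * norm (cond_exp k \<xi>) = \<xi> \<bullet> hembed (cond_exp k \<xi>)"
    by (subst cond_exp_inner[OF level_cond_exp, symmetric]) (simp add: dot_square_norm power2_eq_square)
  also have "\<dots> \<le> norm \<xi> * norm (cond_exp k \<xi>)"
    using norm_cauchy_schwarz[of \<xi> "hembed (cond_exp k \<xi>)"] by (simp add: norm_hembed)
  finally show ?thesis using False by simp
qed simp

lemma cond_exp_tendsto: "(\<lambda>k. hembed (cond_exp k \<xi>)) \<longlonglongrightarrow> \<xi>"
proof (rule LIMSEQ_I)
  fix e :: real assume e: "e > 0"
  obtain y where y: "norm (hembed y - \<xi>) < e / 2" using hembed_dense[of "e / 2" \<xi>] e by auto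
  obtain l where l: "level l y" using level_exists by blast
  have "norm (hembed (cond_exp k \<xi>) - \<xi>) < e" if "k \<ge> l" for k
  proof -
    have "hembed (cond_exp k \<xi>) - \<xi> = (hembed y - \<xi>) - hembed (cond_exp k (hembed y - \<xi>))"
      by (simp add: cond_exp_diff cond_exp_level[OF level_mono[OF l that]] hembed_diff)
    then have "norm (hembed (cond_exp k \<xi>) - \<xi>) \<le> norm (hembed y - \<xi>) + norm (cond_exp k (hembed y - \<xi>))"
      using norm_triangle_ineq4 by (metis norm_hembed)
    then show ?thesis using y norm_cond_exp[of k "hembed y - \<xi>"] by simp
  qed
  then show "\<exists>no. \<forall>k\<ge>no. norm (hembed (cond_exp k \<xi>) - \<xi>) < e" by blast
qed

lemma sum_nb_eq_sum_idx:
  "(\<Sum>g\<in>nb k t. F g) = (\<Sum>r\<in>idx k. F (\<lambda>j. if j < k then r j else t j))"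
proof -
  have "(\<Sum>g\<in>nb k t. F g) = (\<Sum>g\<in>nb k t. F (\<lambda>j. if j < k then cutoff k g j else t j))"
    by (intro sum.cong refl arg_cong[of _ _ F]) (auto simp: nb_def agree_def)
  also have "\<dots> = (\<Sum>r\<in>idx k. F (\<lambda>j. if j < k then r j else t j))"
    by (rule sum.reindex_bij_betw[OF bij_cut_nb])
  finally show ?thesis .
qed

text \<open>
  Every index of level \<open>l\<close> lies in the neighbourhoods of exactly $n^k$ indices of level \<open>l\<close>, those
  that agree with it from position \<open>k\<close> on. The double count replaces a partition of the indices into
  blocks.
\<close>

lemma sum_idx_nb:
  fixes F :: "(nat \<Rightarrow> 'n::finite) \<Rightarrow> real"
  assumes kl: "k \<le> l"
  shows "(\<Sum>t\<in>idx l. \<Sum>p\<in>nb k t. F p) = real CARD('n) ^ k * (\<Sum>p\<in>idx l. F p)"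
proof -
  have nbl: "nb k p \<subseteq> idx l" if "p \<in> idx l" for p :: "nat \<Rightarrow> 'n"
    using that kl by (auto simp: nb_def agree_def PiE_iff extensional_def)
  have mask: "(\<Sum>g\<in>idx l. if g \<in> nb k p then G g else 0) = (\<Sum>g\<in>nb k p. G g)"
    if "p \<in> idx l" for p :: "nat \<Rightarrow> 'n" and G :: "_ \<Rightarrow> real"
    using sum.inter_restrict[of "idx l" G "nb k p"] nbl[OF that] by (simp add: Int_absorb1)
  have "(\<Sum>t\<in>idx l. \<Sum>p\<in>nb k t. F p) = (\<Sum>t\<in>idx l. \<Sum>p\<in>idx l. if t \<in> nb k p then F p else 0)"
    by (rule sum.cong[OF refl], subst mask[symmetric]) (simp_all add: nb_def agree_sym)
  also have "\<dots> = (\<Sum>p\<in>idx l. \<Sum>t\<in>idx l. if t \<in> nb k p then F p else 0)"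
    by (rule sum.swap)
  finally show ?thesis by (simp add: mask card_nb sum_distrib_left)
qed

text \<open>
  An element \<open>x\<close> of level \<open>k\<close> acts on higher levels as a direct sum of copies of its action on
  columns of length $n^k$, so its operator norm can be computed within level \<open>k\<close>. A single column is
  tested by the matrix of level \<open>k\<close> all of whose columns equal it, which scales both norms alike.
\<close>

lemma norm_mult_bound_from_level:
  fixes x :: "'n::finite tower"
  assumes x: "level k x" and C: "\<And>a. level k a \<Longrightarrow> norm (x * a) \<le> C * norm a" "0 \<le> C"
  shows "norm (x * a) \<le> C * norm a"
proof -
  have C2: "(x * a) \<bullet> (x * a) \<le> C\<^sup>2 * (a \<bullet> a)" if "level k a" for a
    using power_mono[OF C(1)[OF that], of 2] by (simp add: power_mult_distrib flip: dot_square_norm)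
  have column: "(\<Sum>p\<in>idx k. (cmod (\<Sum>r\<in>idx k. entry x p r * c r))\<^sup>2) \<le> C\<^sup>2 * (\<Sum>r\<in>idx k. (cmod (c r))\<^sup>2)" for c
    using C2[OF level_of_block[of k "\<lambda>p q. c p"]]
    unfolding inner_tower_self[OF level_ops(2)[OF x level_of_block]] inner_tower_self[OF level_of_block]
    by (simp add: entry_mult_idx[OF x level_of_block] entry_of_block card_PiE)
  \<comment> \<open>The column \<open>h\<close> of \<open>a\<close>, restricted to the rows that agree with \<open>t\<close> from position \<open>k\<close> on.\<close>
  have block: "(\<Sum>p\<in>nb k t. (cmod (entry (x * a) p h))\<^sup>2) \<le> C\<^sup>2 * (\<Sum>p\<in>nb k t. (cmod (entry a p h))\<^sup>2)" for t h
  proof -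
    define ext where "ext r = (\<lambda>j. if j < k then r j else t j)" for r
    have ext: "agree k (ext r) (ext s)" "cutoff k (ext r) = r" if "r \<in> idx k" for r s
      using that by (auto simp: ext_def agree_def fun_eq_iff PiE_iff extensional_def)
    have nbe: "nb k (ext r) = nb k t" for r by (auto simp: nb_def agree_def ext_def)
    have "entry (x * a) (ext p) h = (\<Sum>r\<in>idx k. entry x p r * entry a (ext r) h)" if p: "p \<in> idx k" for p
      unfolding entry_mult_nb[OF x] nbe sum_nb_eq_sum_idx[of _ k t] ext_def[symmetric]
    proof (rule sum.cong[OF refl])
      fix r :: "nat \<Rightarrow> 'n" assume "r \<in> idx k"
      then have "entry x (ext p) (ext r) = entry x p r"
        using entry_cut[OF x ext(1)[OF p, of r]] ext(2) p by simp
      then show "entry x (ext p) (ext r) * entry a (ext r) h = entry x p r * entry a (ext r) h" by simp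
    qed
    then show ?thesis
      using column[of "\<lambda>r. entry a (ext r) h"] by (simp add: sum_nb_eq_sum_idx[of _ k t] flip: ext_def)
  qed
  obtain l0 where l0: "level l0 a" using level_exists by blast
  define l where "l = max k l0"
  have l: "level l x" "level l a" "k \<le> l" using level_mono[OF l0] level_mono[OF x] by (auto simp: l_def)
  have "(\<Sum>p\<in>idx l. (cmod (entry (x * a) p h))\<^sup>2) \<le> C\<^sup>2 * (\<Sum>p\<in>idx l. (cmod (entry a p h))\<^sup>2)" for h
  proof -
    have "real CARD('n) ^ k * (\<Sum>p\<in>idx l. (cmod (entry (x * a) p h))\<^sup>2)
      \<le> real CARD('n) ^ k * (C\<^sup>2 * (\<Sum>p\<in>idx l. (cmod (entry a p h))\<^sup>2))"
      unfolding mult.left_commute[of _ "C\<^sup>2"] sum_idx_nb[OF l(3), symmetric] sum_distrib_left[of "C\<^sup>2" _ "idx l"]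
      by (rule sum_mono) (simp add: block flip: sum_distrib_left)
    then show ?thesis by simp
  qed
  then have "(x * a) \<bullet> (x * a) \<le> C\<^sup>2 * (a \<bullet> a)"
    unfolding inner_tower_self[OF level_ops(2)[OF l(1,2)]] inner_tower_self[OF l(2)]
    by (simp add: sum_distrib_left divide_right_mono sum_mono)
  then have "sqrt ((x * a) \<bullet> (x * a)) \<le> sqrt (C\<^sup>2 * (a \<bullet> a))" by (rule real_sqrt_le_mono)
  then show ?thesis using C(2) by (simp add: norm_eq_sqrt_inner real_sqrt_mult)
qed

text \<open>
  Uniform boundedness lets convergence on the dense copy of the original space spread to all vectors,
  and the same bound makes the pointwise limit a bounded operator.
\<close>

lemma strong_limit_exists:
  fixes f :: "nat \<Rightarrow> 'a::real_inner hcompletion \<Rightarrow>\<^sub>L 'b::{real_normed_vector, complete_space}"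
  assumes bd: "\<And>n \<xi>. norm (f n \<xi>) \<le> C * norm \<xi>"
    and conv: "\<And>x. Cauchy (\<lambda>n. f n (hembed x))"
  obtains T where "\<And>\<xi>. (\<lambda>n. f n \<xi>) \<longlonglongrightarrow> blinfun_apply T \<xi>"
proof -
  have C: "norm (f n \<xi>) \<le> (\<bar>C\<bar> + 1) * norm \<xi>" for n \<xi>
    by (rule order_trans[OF bd]) (rule mult_right_mono, simp_all)
  have cauchy: "Cauchy (\<lambda>n. f n \<xi>)" for \<xi>
  proof (rule CauchyI)
    fix e :: real assume e: "e > 0"
    obtain y where y: "norm (hembed y - \<xi>) < e / (3 * (\<bar>C\<bar> + 1))"
      using hembed_dense[of "e / (3 * (\<bar>C\<bar> + 1))" \<xi>] e by auto
    have d: "norm (f n (hembed y - \<xi>)) < e / 3" for n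
    proof -
      have "norm (f n (hembed y - \<xi>)) \<le> (\<bar>C\<bar> + 1) * norm (hembed y - \<xi>)" by (rule C)
      also have "\<dots> < (\<bar>C\<bar> + 1) * (e / (3 * (\<bar>C\<bar> + 1)))"
        by (rule mult_strict_left_mono[OF y]) simp
      also have "\<dots> = e / 3" by (simp add: field_simps)
      finally show ?thesis .
    qed
    obtain M where M: "\<And>m n. m \<ge> M \<Longrightarrow> n \<ge> M \<Longrightarrow> norm (f m (hembed y) - f n (hembed y)) < e / 3"
      using CauchyD[OF conv[of y], of "e / 3"] e by auto
    have "norm (f m \<xi> - f n \<xi>) < e" if "m \<ge> M" "n \<ge> M" for m n
    proof -
      have eq: "f m \<xi> - f n \<xi> = (f m (hembed y) - f n (hembed y)) - (f m (hembed y - \<xi>) - f n (hembed y - \<xi>))"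
        by (simp add: blinfun.diff_right)
      have "norm (f m \<xi> - f n \<xi>) \<le> norm (f m (hembed y) - f n (hembed y)) + (norm (f m (hembed y - \<xi>)) + norm (f n (hembed y - \<xi>)))"
        unfolding eq by (intro order_trans[OF norm_triangle_ineq4] add_mono order_refl norm_triangle_ineq4)
      then show ?thesis using M[OF that] d[of m] d[of n] by simp
    qed
    then show "\<exists>M. \<forall>m\<ge>M. \<forall>n\<ge>M. norm (f m \<xi> - f n \<xi>) < e" by blast
  qed
  define L where "L \<xi> = lim (\<lambda>n. f n \<xi>)" for \<xi>
  have L: "(\<lambda>n. f n \<xi>) \<longlonglongrightarrow> L \<xi>" for \<xi>
    using cauchy[of \<xi>] unfolding L_def by (simp add: Cauchy_convergent_iff convergent_LIMSEQ_iff)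
  have "bounded_linear L"
  proof (rule bounded_linear_intro[where K = "\<bar>C\<bar> + 1"])
    show "L (\<xi> + \<eta>) = L \<xi> + L \<eta>" for \<xi> \<eta>
      using LIMSEQ_unique[OF L[of "\<xi> + \<eta>"]] tendsto_add[OF L L] by (simp add: blinfun.add_right)
    show "L (r *\<^sub>R \<xi>) = r *\<^sub>R L \<xi>" for r \<xi>
      using LIMSEQ_unique[OF L[of "r *\<^sub>R \<xi>"]] tendsto_scaleR[OF tendsto_const L] by (simp add: blinfun.scaleR_right)
    show "norm (L \<xi>) \<le> norm \<xi> * (\<bar>C\<bar> + 1)" for \<xi>
      by (rule LIMSEQ_le_const2[OF tendsto_norm[OF L]]) (use C in \<open>auto simp: mult.commute\<close>)
  qed
  then have "(\<lambda>n. f n \<xi>) \<longlonglongrightarrow> blinfun_apply (Blinfun L) \<xi>" for \<xi>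
    using L by (simp add: bounded_linear_Blinfun_apply)
  then show ?thesis by (rule that)
qed

lemma strong_limit_in_closure:
  assumes "\<And>n. f n \<in> A" "\<And>\<xi>. (\<lambda>n. blinfun_apply (f n) \<xi>) \<longlonglongrightarrow> blinfun_apply T \<xi>"
  shows "T \<in> strong_operator_topology closure_of A"
  unfolding in_closure_of strong_operator_topology_topspace
proof (intro conjI UNIV_I allI impI)
  fix V assume V: "T \<in> V \<and> openin strong_operator_topology V"
  then obtain U where U: "open U" "V = blinfun_apply -` U"
    unfolding strong_operator_topology_def openin_pullback_topology by auto
  have "limitin (product_topology (\<lambda>_. euclidean) UNIV) (\<lambda>n. blinfun_apply (f n)) (blinfun_apply T) sequentially"
    unfolding limitin_componentwise using assms(2) by auto
  then have "eventually (\<lambda>n. blinfun_apply (f n) \<in> U) sequentially"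
    using U V unfolding limitin_def open_fun_def by auto
  then obtain n where "blinfun_apply (f n) \<in> U" unfolding eventually_sequentially by blast
  with assms(1) U show "\<exists>y. y \<in> A \<and> y \<in> V" by blast
qed

text \<open>
  The algebras $A_{2k}$ alone are the full levels from 1 on, and the levels increase. Hence the
  hyperfinite factor is the strong closure of all left multiplications.
\<close>

lemma tower_alg_exhausts: "(\<Union>m. tower_alg m) = (UNIV :: 'n::finite tower set)"
proof (intro equalityI subsetI UNIV_I)
  fix X :: "'n tower"
  obtain k where "level k X" using level_exists by blast
  then have "level (Suc k) X" by (rule level_mono) simp
  then have "X \<in> tower_alg (2 * k)" by (simp add: tower_alg_def)
  then show "X \<in> (\<Union>m. tower_alg m)" by blast
qed

lemma hyperfinite_R_eq: "hyperfinite_R = strong_operator_topology closure_of range lmult"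
  by (simp add: hyperfinite_R_def tower_alg_exhausts)

lemma closedin_commuting:
  "closedin strong_operator_topology {T. T o\<^sub>L S = S o\<^sub>L T}" for S :: "'a::real_normed_vector \<Rightarrow>\<^sub>L 'a"
proof -
  have "closedin strong_operator_topology {T \<in> topspace strong_operator_topology. blinfun_apply T (S \<xi>) = S (blinfun_apply T \<xi>)}" for \<xi>
  proof (rule closedin_continuous_maps_eq[where Y = euclidean])
    show "continuous_map strong_operator_topology euclidean (\<lambda>T. blinfun_apply T (S \<xi>))"
      by (rule strong_operator_topology_continuous_evaluation)
    have "continuous_map strong_operator_topology euclidean (blinfun_apply S \<circ> (\<lambda>T. blinfun_apply T \<xi>))"
      by (rule continuous_map_compose[OF strong_operator_topology_continuous_evaluation])
         (simp add: blinfun.continuous_on continuous_on_id)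
    then show "continuous_map strong_operator_topology euclidean (\<lambda>T. S (blinfun_apply T \<xi>))"
      by (simp add: o_def)
  qed simp
  then have "closedin strong_operator_topology (\<Inter>\<xi>. {T. blinfun_apply T (S \<xi>) = S (blinfun_apply T \<xi>)})"
    by (intro closedin_Inter) (auto simp: strong_operator_topology_topspace)
  moreover have "(\<Inter>\<xi>. {T. blinfun_apply T (S \<xi>) = S (blinfun_apply T \<xi>)}) = {T. T o\<^sub>L S = S o\<^sub>L T}"
    by (auto simp: blinfun_eq_iff)
  ultimately show ?thesis by simp
qed

lemma hyperfinite_R_commutes: "T \<in> hyperfinite_R \<Longrightarrow> T o\<^sub>L rmult a = rmult a o\<^sub>L T"
  using closure_of_minimal[OF _ closedin_commuting[of "rmult a"], of "range lmult"] lmult_rmult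
  unfolding hyperfinite_R_eq by blast

text \<open>
  The heart of the commutant theorem. An operator \<open>T\<close> that commutes with right multiplications is
  determined by the vector \<open>T 1\<close>, and its projections to the finite levels act as bounded left
  multiplications: on level \<open>k\<close>, left multiplication by \<open>x k\<close> is the compression of \<open>T\<close>, so its
  norm there is at most that of \<open>T\<close>, and \<open>norm_mult_bound_from_level\<close> carries the bound to the
  whole space. Convergence on the dense subspace follows from \<open>x k a = R_a (x k)\<close>, where \<open>R_a\<close> is
  right multiplication by \<open>a\<close>. This uniform bound is what a direct approximation of \<open>T 1\<close> by elements
  of the tower would not give.
\<close>

lemma commutant_approximation:
  fixes T :: "'n::finite gns \<Rightarrow>\<^sub>L 'n gns"
  assumes T: "\<And>a. T o\<^sub>L rmult a = rmult a o\<^sub>L T"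
  defines "x \<equiv> \<lambda>k. cond_exp k (blinfun_apply T (hembed 1))"
  shows "norm (x k * a) \<le> norm T * norm a"
    and "(\<lambda>k. blinfun_apply (lmult (x k)) \<xi>) \<longlonglongrightarrow> blinfun_apply T \<xi>"
proof -
  have r: "blinfun_apply (rmult a) (blinfun_apply T (hembed 1)) = blinfun_apply T (hembed a)" for a
    using blinfun_eq_iff[THEN iffD1, OF T[of a]] by (simp add: rmult_hembed) (metis mult_1 rmult_hembed)
  show bd: "norm (x k * a) \<le> norm T * norm a" for k a
  proof (rule norm_mult_bound_from_level)
    show "level k (x k)" unfolding x_def by (rule level_cond_exp)
    fix a :: "'n tower" assume "level k a"
    then have "x k * a = cond_exp k (blinfun_apply T (hembed a))"
      by (simp add: x_def r flip: cond_exp_rmult)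
    then show "norm (x k * a) \<le> norm T * norm a"
      using norm_cond_exp[of k "blinfun_apply T (hembed a)"] norm_blinfun[of T "hembed a"] by (simp add: norm_hembed)
  qed simp
  have lim: "(\<lambda>k. blinfun_apply (lmult (x k)) (hembed a)) \<longlonglongrightarrow> blinfun_apply T (hembed a)" for a
  proof -
    have "(\<lambda>k. blinfun_apply (rmult a) (hembed (x k))) \<longlonglongrightarrow> blinfun_apply (rmult a) (blinfun_apply T (hembed 1))"
      unfolding x_def by (intro bounded_linear.tendsto[OF blinfun.bounded_linear_right] cond_exp_tendsto)
    then show ?thesis by (simp add: rmult_hembed lmult_hembed r)
  qed
  obtain T' where T': "\<And>\<xi>. (\<lambda>k. blinfun_apply (lmult (x k)) \<xi>) \<longlonglongrightarrow> blinfun_apply T' \<xi>"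
    using strong_limit_exists[of "\<lambda>k. lmult (x k)" "norm T"] lmult_bound[OF bd] LIMSEQ_imp_Cauchy[OF lim] by blast
  have "T' = T" by (rule hextend_eqI) (rule LIMSEQ_unique[OF T' lim])
  with T' show "(\<lambda>k. blinfun_apply (lmult (x k)) \<xi>) \<longlonglongrightarrow> blinfun_apply T \<xi>" by simp
qed

lemma hyperfinite_R_commutant: "hyperfinite_R = {T. \<forall>a. T o\<^sub>L rmult a = rmult a o\<^sub>L T}"
proof (intro equalityI subsetI)
  fix T :: "'a gns \<Rightarrow>\<^sub>L 'a gns" assume "T \<in> {T. \<forall>a. T o\<^sub>L rmult a = rmult a o\<^sub>L T}"
  then have T: "\<And>a. T o\<^sub>L rmult a = rmult a o\<^sub>L T" by blast
  show "T \<in> hyperfinite_R" unfolding hyperfinite_R_eq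
    by (rule strong_limit_in_closure[OF _ commutant_approximation(2)[OF T]]) blast
qed (use hyperfinite_R_commutes in blast)

text \<open>
  Taking adjoints is not continuous for the strong topology, so closedness alone does not produce
  them. Here the trace helps: \<open>X \<mapsto> star X\<close> is isometric, hence the adjoints of the approximants
  from \<open>commutant_approximation\<close> still converge at the vector \<open>1\<close>, then at all vectors of the tower
  by right multiplication, and everywhere by the uniform bound.
\<close>

lemma hyperfinite_R_adjoint:
  assumes "T \<in> hyperfinite_R"
  obtains T' where "T' \<in> hyperfinite_R" "\<And>\<xi> \<eta>. blinfun_apply T \<xi> \<bullet> \<eta> = \<xi> \<bullet> blinfun_apply T' \<eta>"
proof -
  have T: "\<And>a. T o\<^sub>L rmult a = rmult a o\<^sub>L T" using hyperfinite_R_commutes[OF assms] .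
  define x where "x k = cond_exp k (blinfun_apply T (hembed 1))" for k
  note x = commutant_approximation[of T, OF T, folded x_def]
  have bd: "norm (star (x k) * a) \<le> norm T * norm a" for k a
  proof (cases "star (x k) * a = 0")
    case False
    let ?b = "star (x k) * a"
    have "norm ?b * norm ?b = a \<bullet> (x k * ?b)"
      by (simp add: inner_mult_left flip: power2_eq_square dot_square_norm)
    also have "\<dots> \<le> norm a * norm (x k * ?b)" by (rule norm_cauchy_schwarz)
    also have "\<dots> \<le> norm a * (norm T * norm ?b)" by (intro mult_left_mono x(1) norm_ge_zero)
    finally show ?thesis using False by (simp add: mult.commute mult.assoc)
  qed simp
  have xc: "Cauchy (\<lambda>k. hembed (x k))"
    unfolding x_def by (rule LIMSEQ_imp_Cauchy[OF cond_exp_tendsto])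
  then have "Cauchy (\<lambda>k. hembed (star (x k)))"
  proof -
    have "star (a - b) = star a - star b" for a b :: "'a tower" unfolding minus_tower_def by transfer simp
    then have "norm (star a - star b) = norm (a - b)" for a b :: "'a tower" by (metis norm_star)
    then show ?thesis using xc by (simp add: Cauchy_def dist_norm norm_hembed flip: hembed_diff)
  qed
  then have "Cauchy (\<lambda>k. blinfun_apply (rmult a) (hembed (star (x k))))" for a
    by (rule bounded_linear.Cauchy[OF blinfun.bounded_linear_right])
  then have "Cauchy (\<lambda>k. blinfun_apply (lmult (star (x k))) (hembed a))" for a
    by (simp add: rmult_hembed lmult_hembed)
  then obtain T' where T': "\<And>\<xi>. (\<lambda>k. blinfun_apply (lmult (star (x k))) \<xi>) \<longlonglongrightarrow> blinfun_apply T' \<xi>"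
    using strong_limit_exists[of "\<lambda>k. lmult (star (x k))" "norm T"] lmult_bound[OF bd] by blast
  have "blinfun_apply T \<xi> \<bullet> \<eta> = \<xi> \<bullet> blinfun_apply T' \<eta>" for \<xi> \<eta>
    by (rule LIMSEQ_unique[OF tendsto_inner[OF x(2) tendsto_const, of \<xi> \<eta>]])
       (use tendsto_inner[OF tendsto_const T'] in \<open>simp add: lmult_adjoint\<close>)
  moreover have "T' \<in> hyperfinite_R" unfolding hyperfinite_R_eq
    by (rule strong_limit_in_closure[OF _ T']) blast
  ultimately show ?thesis using that by blast
qed

text \<open>
  All conditions but the existence of adjoints are immediate for a commutant; complex linearity is
  included because scalars are right multiplications.
\<close>

lemma von_neumann_algebra_hyperfinite_R: "von_neumann_algebra hyperfinite_R"
  unfolding von_neumann_algebra_def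
proof (intro conjI ballI allI)
  note R = hyperfinite_R_commutant
  show "T o\<^sub>L gns_scaleC c = gns_scaleC c o\<^sub>L T" if "T \<in> hyperfinite_R" for T :: "'a gns \<Rightarrow>\<^sub>L 'a gns" and c
    unfolding gns_scaleC_eq_rmult by (rule hyperfinite_R_commutes[OF that])
  show "id_blinfun \<in> hyperfinite_R" unfolding R by (simp add: blinfun_eq_iff)
  have s: "gns_scaleC c o\<^sub>L rmult a = rmult a o\<^sub>L gns_scaleC c" for c and a :: "'a tower"
    by (rule hextend_eqI) (simp add: rmult_hembed gns_scaleC_hembed scaleC_mult_left)
  show "op.subspace (hyperfinite_R :: ('a gns \<Rightarrow>\<^sub>L 'a gns) set)"
  proof (rule op.subspaceI)
    show "0 \<in> hyperfinite_R" unfolding R by (simp add: blinfun_eq_iff blinfun.zero_right)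
    show "S + T \<in> hyperfinite_R" if "S \<in> hyperfinite_R" "T \<in> hyperfinite_R" for S T :: "'a gns \<Rightarrow>\<^sub>L 'a gns"
      using that unfolding R by (simp add: blinfun_eq_iff blinfun.add_left blinfun.add_right)
    show "op_scaleC c T \<in> hyperfinite_R" if "T \<in> hyperfinite_R" for c and T :: "'a gns \<Rightarrow>\<^sub>L 'a gns"
      using that s[of c] unfolding R op_scaleC_def by (simp add: blinfun_eq_iff)
  qed
  show "S o\<^sub>L T \<in> hyperfinite_R" if "S \<in> hyperfinite_R" "T \<in> hyperfinite_R" for S T :: "'a gns \<Rightarrow>\<^sub>L 'a gns"
    using that unfolding R by (simp add: blinfun_eq_iff)
  show "\<exists>T'\<in>hyperfinite_R. \<forall>\<xi> \<eta>. blinfun_apply T \<xi> \<bullet> \<eta> = \<xi> \<bullet> blinfun_apply T' \<eta>" if "T \<in> hyperfinite_R" for T :: "'a gns \<Rightarrow>\<^sub>L 'a gns"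
    using hyperfinite_R_adjoint[OF that] by metis
  show "closedin strong_operator_topology (hyperfinite_R :: ('a gns \<Rightarrow>\<^sub>L 'a gns) set)"
    unfolding hyperfinite_R_eq by simp
qed

lemma lmult_in_hyperfinite_R: "lmult x \<in> hyperfinite_R"
  unfolding hyperfinite_R_commutant by (simp add: lmult_rmult)

text \<open>
  The adjoints found in the different algebras coincide, since an adjoint is unique.
\<close>

lemma von_neumann_algebra_Inter:
  assumes "\<N> \<noteq> {}" and vN: "\<And>N. N \<in> \<N> \<Longrightarrow> von_neumann_algebra N"
  shows "von_neumann_algebra (\<Inter>\<N>)"
proof -
  obtain N0 where N0: "N0 \<in> \<N>" using assms by blast
  note d = vN[unfolded von_neumann_algebra_def]
  have "\<exists>T'\<in>\<Inter>\<N>. \<forall>\<xi> \<eta>. blinfun_apply T \<xi> \<bullet> \<eta> = \<xi> \<bullet> blinfun_apply T' \<eta>" if T: "T \<in> \<Inter>\<N>" for T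
  proof -
    obtain T' where T': "\<And>\<xi> \<eta>. blinfun_apply T \<xi> \<bullet> \<eta> = \<xi> \<bullet> blinfun_apply T' \<eta>"
      using d[OF N0] T N0 by blast
    have "T' \<in> N" if N: "N \<in> \<N>" for N
    proof -
      obtain T'' where T'': "T'' \<in> N" "\<And>\<xi> \<eta>. blinfun_apply T \<xi> \<bullet> \<eta> = \<xi> \<bullet> blinfun_apply T'' \<eta>"
        using d[OF N] T N by blast
      have "T'' = T'"
        by (rule blinfun_eqI, rule vector_eq_ldot[THEN iffD1]) (use T' T'' in metis)
      then show ?thesis using T'' by simp
    qed
    then show ?thesis using T' by blast
  qed
  moreover have "op.subspace (\<Inter>\<N>)"
    using d by (intro op.subspaceI) (auto simp: op.subspace_def)
  moreover have "closedin strong_operator_topology (\<Inter>\<N>)"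
    using d assms(1) by (intro closedin_Inter) auto
  ultimately show ?thesis
    unfolding von_neumann_algebra_def using d N0 by blast
qed

text \<open>
  The hyperfinite factor itself competes in the intersection, which is therefore not the empty one.
\<close>

lemma von_neumann_algebra_vN_generated:
  assumes "S \<subseteq> range lmult"
  shows "von_neumann_algebra (vN_generated S)" "vN_generated S \<subseteq> hyperfinite_R"
proof -
  have "hyperfinite_R \<in> {N. von_neumann_algebra N \<and> S \<subseteq> N}"
    using assms lmult_in_hyperfinite_R von_neumann_algebra_hyperfinite_R by auto
  then show "von_neumann_algebra (vN_generated S)" "vN_generated S \<subseteq> hyperfinite_R"
    unfolding vN_generated_def by (auto intro!: von_neumann_algebra_Inter)
qed

lemma vN_generated_superset: "S \<subseteq> vN_generated S"
  unfolding vN_generated_def by blast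

section \<open>Products of two spin model subfactors\<close>

lemma lmult_ops:
  "lmult (a + b) = lmult a + lmult b"
  "lmult (a * b) = lmult a o\<^sub>L lmult b"
  "lmult (- a) = - lmult a"
  "lmult 1 = id_blinfun"
proof -
  show "lmult (a + b) = lmult a + lmult b"
    by (rule hextend_eqI) (simp add: lmult_hembed distrib_right hembed_add blinfun.add_left)
  show "lmult (a * b) = lmult a o\<^sub>L lmult b"
    by (rule hextend_eqI) (simp add: lmult_hembed mult.assoc)
  have "hembed (- X) = - hembed X" for X :: "'a tower" using hembed_scaleR[of "-1" X] by simp
  then show "lmult (- a) = - lmult a"
    by (intro hextend_eqI) (simp add: lmult_hembed blinfun.minus_left)
  show "lmult 1 = id_blinfun"
    by (rule hextend_eqI) (simp add: lmult_hembed)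
qed

lemma spin_model_von_neumann:
  "von_neumann_algebra (spin_model u)" "spin_model u \<subseteq> hyperfinite_R"
  unfolding spin_model_def by (rule von_neumann_algebra_vN_generated, blast)+

lemma spin_model_generators:
  "d \<in> diag_matrices \<Longrightarrow> lmult (site 0 (u ** d ** conj_transpose u)) \<in> spin_model u"
  "j \<ge> 1 \<Longrightarrow> lmult (jones_proj j) \<in> spin_model u"
  unfolding spin_model_def by (rule subsetD[OF vN_generated_superset], blast)+

lemma jones_proj_site0_commute:
  fixes m :: "complex ^ 'n::finite ^ 'n"
  assumes "j \<ge> 2"
  shows "jones_proj j * site 0 m = site 0 m * jones_proj j"
proof (cases "even j")
  case True
  then obtain k where "j = 2 * k" by blast
  with assms show ?thesis using site_commute[of k 0] by (simp add: jones_proj_even)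
next
  case False
  then obtain k where j: "j = Suc (2 * k)" by (auto elim: oddE)
  with assms have k: "k \<noteq> 0" by simp
  have diagonal: "\<forall>f g :: nat \<Rightarrow> 'n. f \<noteq> g \<longrightarrow> entry (jones_proj j) f g = 0"
    by (simp add: j entry_jones_proj_odd)
  show ?thesis
  proof (rule tower_ext)
    fix f h
    show "entry (jones_proj j * site 0 m) f h = entry (site 0 m * jones_proj j) f h"
      unfolding entry_mult_diagonal[of "jones_proj j", OF diagonal]
      using k by (simp add: j entry_jones_proj_odd entry_site eq_off_def)
  qed
qed

text \<open>
  The first Jones projection is the only one that does not commute with the matrices at position 0.
  It commutes with diagonal matrices. An off-diagonal \<open>2 \<times> 2\<close> matrix flips the value at position
  0, and as there are only two values, it exchanges the projection onto equal values at the positions 0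
  and 1 with its complement.
\<close>

lemma jones_proj_1_site0:
  fixes m :: "complex ^ 2 ^ 2"
  shows "jones_proj 1 * site 0 m = site 0 (\<chi> i j. if i = j then m $ i $ j else 0) * jones_proj 1
    + site 0 (\<chi> i j. if i = j then 0 else m $ i $ j) * (1 - jones_proj 1)"
proof (rule tower_ext)
  fix f h :: "nat \<Rightarrow> 2"
  have e: "entry (jones_proj 1) f g = (if f = g \<and> f 0 = f 1 then 1 else 0)" for f g :: "nat \<Rightarrow> 2"
    unfolding One_nat_def by (rule entry_jones_proj_odd[of 0 f g, unfolded mult_0_right])
  have e': "entry (1 - jones_proj 1) f g = (if f = g \<and> f 0 \<noteq> f 1 then 1 else 0)" for f g :: "nat \<Rightarrow> 2"
    by (simp add: entry_diff entry_one e[unfolded One_nat_def])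
  \<comment> \<open>Only in a two-element type do two disagreements with \<open>c\<close> amount to an agreement.\<close>
  have two: "(a = b) = ((c = b) = (a = c))" for a b c :: 2
    using exhaust_2[of a] exhaust_2[of b] exhaust_2[of c] by auto
  have d: "\<forall>f g :: nat \<Rightarrow> 2. f \<noteq> g \<longrightarrow> entry (jones_proj 1) f g = 0"
    "\<forall>f g :: nat \<Rightarrow> 2. f \<noteq> g \<longrightarrow> entry (1 - jones_proj 1) f g = 0"
    unfolding e e' by simp_all
  note compress = entry_mult_diagonal[of "jones_proj 1", OF d(1)] entry_mult_diagonal(2)[of "1 - jones_proj 1", OF d(2)]
  have "eq_off 0 f h \<Longrightarrow> f 1 = h 1" by (simp add: eq_off_def)
  then show "entry (jones_proj 1 * site 0 m) f h = entry (site 0 (\<chi> i j. if i = j then m $ i $ j else 0) * jones_proj 1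
    + site 0 (\<chi> i j. if i = j then 0 else m $ i $ j) * (1 - jones_proj 1)) f h"
    unfolding entry_ops compress e e' entry_site using two[of "f 0" "f 1" "h 0"]
    by (cases "f 0 = f 1"; cases "f 0 = h 0"; cases "eq_off 0 f h") simp_all
qed

text \<open>
  The complex span of these products, if \<open>C\<close> is not empty: closing under sums is enough, because a
  scalar can be absorbed into the matrix at position 0.
\<close>

inductive_set site0_module :: "'n::finite tower set \<Rightarrow> 'n tower set" for C where
  gen: "s \<in> C \<Longrightarrow> site 0 m * s \<in> site0_module C"
| add: "X \<in> site0_module C \<Longrightarrow> Y \<in> site0_module C \<Longrightarrow> X + Y \<in> site0_module C"

text \<open>
  For \<open>2 \<times> 2\<close> matrices, moving a Jones projection past a matrix at position 0 costs at most a
  change to \<open>1 - jones_proj 1\<close>. So the span is stable under left multiplication by all generators of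
  the tower, and it contains 1.
\<close>

lemma site0_module_UNIV:
  fixes C :: "2 tower set"
  assumes one: "1 \<in> C" and jones: "\<And>j. j \<ge> 1 \<Longrightarrow> jones_proj j \<in> C"
    and mult: "\<And>X Y. X \<in> C \<Longrightarrow> Y \<in> C \<Longrightarrow> X * Y \<in> C"
    and diff: "\<And>X Y. X \<in> C \<Longrightarrow> Y \<in> C \<Longrightarrow> X - Y \<in> C"
  shows "X \<in> site0_module C"
proof -
  have left: "A * Z \<in> site0_module C"
    if gens: "\<And>m s. s \<in> C \<Longrightarrow> A * (site 0 m * s) \<in> site0_module C" and Z: "Z \<in> site0_module C" for A Z
    using Z by induction (simp_all add: gens distrib_left site0_module.add)
  have "\<forall>Z\<in>site0_module C. X * Z \<in> site0_module C"
  proof (rule tower_induct_jones[of "\<lambda>X. \<forall>Z\<in>site0_module C. X * Z \<in> site0_module C"])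
    fix m
    show "\<forall>Z\<in>site0_module C. site 0 m * Z \<in> site0_module C"
      by (rule ballI, rule left) (simp_all add: site_mult site0_module.gen flip: mult.assoc)
  next
    fix j :: nat assume j: "j \<ge> 1"
    have "jones_proj j * (site 0 m * s) \<in> site0_module C" if s: "s \<in> C" for m s
    proof (cases "j = 1")
      case True
      show ?thesis
        unfolding True mult.assoc[symmetric] jones_proj_1_site0 distrib_right
        unfolding mult.assoc by (intro site0_module.intros mult diff one jones s) auto
    next
      case False
      then have "jones_proj j * (site 0 m * s) = site 0 m * (jones_proj j * s)"
        using jones_proj_site0_commute[of j m] j by (simp flip: mult.assoc)
      then show ?thesis using mult[OF jones[OF j] s] by (simp add: site0_module.gen)
    qed
    then show "\<forall>Z\<in>site0_module C. jones_proj j * Z \<in> site0_module C" by (blast intro: left)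
  qed (simp_all add: distrib_right mult.assoc site0_module.add)
  moreover have "1 \<in> site0_module C"
    using site0_module.gen[OF one, of "mat 1"] by (simp only: site_mat scaleC_one mult_1)
  ultimately have "X * 1 \<in> site0_module C" by blast
  then show ?thesis by simp
qed

text \<open>
  The matrix $s I + t \sigma_\theta$ with $\sigma_\theta = \cos\theta\, \sigma_x + \sin\theta\, \sigma_y$
  in terms of Pauli matrices.
\<close>

definition phase_matrix :: "real \<Rightarrow> complex \<Rightarrow> complex \<Rightarrow> complex ^ 2 ^ 2" where
  "phase_matrix \<theta> s t = vector [vector [s, t * cis (- \<theta>)], vector [t * cis \<theta>, s]]"

lemma phase_matrix_conjugate:
  fixes u :: "complex ^ 2 ^ 2"
  assumes u: "u = (1 / sqrt 2) *\<^sub>R vector [vector [1, 1],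
           vector [exp (\<i> * of_real \<theta>), - exp (\<i> * of_real \<theta>)]]"
  shows "\<exists>d\<in>diag_matrices. phase_matrix \<theta> s t = u ** d ** conj_transpose u"
proof
  \<comment> \<open>The columns of \<open>u\<close> are eigenvectors of $\sigma_\theta$ for the eigenvalues 1 and -1.\<close>
  let ?d = "vector [vector [s + t, 0], vector [0, s - t]] :: complex ^ 2 ^ 2"
  show "?d \<in> diag_matrices" by (simp add: diag_matrices_def forall_2)
  define r where "r = complex_of_real (1 / sqrt 2)"
  have "(1 / sqrt 2) * (1 / sqrt 2) = (1 / 2 :: real)" by simp
  then have rr: "r * r = 1 / 2" unfolding r_def by (metis of_real_mult of_real_1 of_real_divide of_real_numeral)
  then have rr': "r * (r * z) = z / 2" for z by (simp flip: mult.assoc)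
  have cr: "cnj r = r" by (simp add: r_def)
  have cc: "cis \<theta> * cis (- \<theta>) = 1" "cis (- \<theta>) * cis \<theta> = 1" by (simp_all add: cis_mult)
  then have cc': "cis \<theta> * (cis (- \<theta>) * z) = z" "cis (- \<theta>) * (cis \<theta> * z) = z" for z
    by (simp_all flip: mult.assoc)
  have ue: "u $ 1 $ 1 = r" "u $ 1 $ 2 = r" "u $ 2 $ 1 = r * cis \<theta>" "u $ 2 $ 2 = - (r * cis \<theta>)"
    unfolding u r_def vector_scaleR_component by (simp_all add: scaleR_conv_of_real cis_conv_exp)
  show "phase_matrix \<theta> s t = u ** ?d ** conj_transpose u"
    by (simp add: vec_eq_iff forall_2 matrix_matrix_mult_def sum_2 conj_transpose_def ue cr cis_cnj phase_matrix_def)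
       (simp add: algebra_simps cc' cc rr rr')
qed

text \<open>
  The product $\sigma_\alpha \sigma_\beta$ is the diagonal matrix with entries
  $e^{\pm i(\beta - \alpha)}$. If these differ, then $I$ and $\sigma_\alpha \sigma_\beta$ span the
  diagonal matrices, while $\sigma_\alpha$ and $\sigma_\beta$ span the off-diagonal ones. Both systems
  of linear equations have the determinant \<open>D\<close> below, up to sign.
\<close>

lemma phase_matrix_products_span:
  fixes m :: "complex ^ 2 ^ 2"
  assumes "sin (\<beta> - \<alpha>) \<noteq> 0"
  shows "\<exists>a b c d. m = phase_matrix \<alpha> a b ** phase_matrix \<beta> 1 0
    + phase_matrix \<alpha> 1 0 ** phase_matrix \<beta> 0 c + phase_matrix \<alpha> 0 1 ** phase_matrix \<beta> 0 d"
proof -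
  define p p' q q' where "p = cis \<alpha>" "p' = cis (- \<alpha>)" "q = cis \<beta>" "q' = cis (- \<beta>)"
  note pq = this
  have one: "p * p' = 1" "q * q' = 1" by (simp_all add: pq cis_mult)
  define D where "D = p' * q - p * q'"
  have "Im D = 2 * sin (\<beta> - \<alpha>)"
    using sin_minus[of "\<beta> - \<alpha>"] by (simp add: D_def pq cis_mult)
  with assms have D: "D \<noteq> 0" by auto
  define d where "d = (m $ 1 $ 1 - m $ 2 $ 2) / D"
  define a where "a = m $ 1 $ 1 - d * (p' * q)"
  define c where "c = (m $ 2 $ 1 * p' - m $ 1 $ 2 * p) / D"
  define b where "b = m $ 1 $ 2 * p - c * (p * q')"
  have d: "d * D = m $ 1 $ 1 - m $ 2 $ 2" "c * D = m $ 2 $ 1 * p' - m $ 1 $ 2 * p"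
    using D by (simp_all add: d_def c_def)
  have "m $ 1 $ 1 = a + d * (p' * q)" by (simp add: a_def)
  moreover have "m $ 2 $ 2 = a + d * (p * q')" using d(1) by (simp add: a_def D_def algebra_simps)
  moreover have "m $ 1 $ 2 = b * p' + c * q'"
  proof -
    have "b * p' + c * q' = m $ 1 $ 2 * (p * p') - c * q' * (p * p') + c * q'"
      by (simp add: b_def algebra_simps)
    then show ?thesis by (simp add: one)
  qed
  moreover have "m $ 2 $ 1 = b * p + c * q"
  proof -
    have "b * p + c * q = m $ 1 $ 2 * (p * p) + p * (c * (p' * q - p * q')) + c * q * (1 - p * p')"
      by (simp add: b_def algebra_simps)
    also have "\<dots> = m $ 1 $ 2 * (p * p) + p * (m $ 2 $ 1 * p' - m $ 1 $ 2 * p)"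
      using d(2) by (simp add: D_def one)
    also have "\<dots> = m $ 2 $ 1 * (p * p')" by (simp add: algebra_simps)
    finally show ?thesis by (simp add: one)
  qed
  ultimately have "m = phase_matrix \<alpha> a b ** phase_matrix \<beta> 1 0
    + phase_matrix \<alpha> 1 0 ** phase_matrix \<beta> 0 c + phase_matrix \<alpha> 0 1 ** phase_matrix \<beta> 0 d"
    by (simp add: vec_eq_iff forall_2 matrix_matrix_mult_def sum_2 phase_matrix_def mult_ac flip: pq)
  then show ?thesis by blast
qed

text \<open>
  A matrix at position 0 is a sum of products of generators of the two algebras. The remaining factors
  lie in the second algebra, which contains all Jones projections, so that each summand is a product of
  an element of the first algebra and one of the second. Hence the products span all left
  multiplications, even before taking the closure.
\<close>

lemma product_span_spin_models_dense:
  fixes u v :: "complex ^ 2 ^ 2"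
  assumes u: "u = (1 / sqrt 2) *\<^sub>R vector [vector [1, 1],
           vector [exp (\<i> * of_real \<alpha>), - exp (\<i> * of_real \<alpha>)]]"
    and v: "v = (1 / sqrt 2) *\<^sub>R vector [vector [1, 1],
           vector [exp (\<i> * of_real \<beta>), - exp (\<i> * of_real \<beta>)]]"
    and sin: "sin (\<beta> - \<alpha>) \<noteq> 0"
  shows "strong_operator_topology closure_of product_span (spin_model u) (spin_model v) = hyperfinite_R"
proof
  have R: "op.subspace hyperfinite_R" "closedin strong_operator_topology hyperfinite_R"
    "\<And>S T. S \<in> hyperfinite_R \<Longrightarrow> T \<in> hyperfinite_R \<Longrightarrow> S o\<^sub>L T \<in> hyperfinite_R"
    using von_neumann_algebra_hyperfinite_R unfolding von_neumann_algebra_def by blast+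
  have "product_span (spin_model u) (spin_model v) \<subseteq> hyperfinite_R"
    unfolding product_span_def
    by (rule op.span_minimal) (use R spin_model_von_neumann(2) in blast)+
  then show "strong_operator_topology closure_of product_span (spin_model u) (spin_model v) \<subseteq> hyperfinite_R"
    using R(2) by (rule closure_of_minimal)
  note V = spin_model_von_neumann(1)[of v, unfolded von_neumann_algebra_def]
  define C where "C = {s. lmult s \<in> spin_model v}"
  have "lmult X \<in> product_span (spin_model u) (spin_model v)" for X
  proof -
    have du: "lmult (site 0 (phase_matrix \<alpha> s t)) \<in> spin_model u"
      and dv: "lmult (site 0 (phase_matrix \<beta> s t)) \<in> spin_model v" for s t
      using phase_matrix_conjugate[OF u, of s t] phase_matrix_conjugate[OF v, of s t]
      by (auto simp: spin_model_generators(1))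
    have mult_C: "X * Y \<in> C" if "X \<in> C" "Y \<in> C" for X Y using that V by (simp add: C_def lmult_ops)
    have "X \<in> site0_module C"
    proof (rule site0_module_UNIV)
      show "1 \<in> C" using V by (simp add: C_def lmult_ops)
      show "jones_proj j \<in> C" if "j \<ge> 1" for j using that by (simp add: C_def spin_model_generators)
      show "X - Y \<in> C" if "X \<in> C" "Y \<in> C" for X Y
        using that V op.subspace_diff[of "spin_model v" "lmult X" "lmult Y"]
        by (simp add: C_def lmult_ops diff_conv_add_uminus del: add_uminus_conv_diff)
    qed (rule mult_C)
    then show ?thesis
    proof induction
      case (gen s m)
      have sp: "lmult (site 0 (phase_matrix \<alpha> a b ** phase_matrix \<beta> c d) * s)
          \<in> product_span (spin_model u) (spin_model v)" for a b c d
      proof -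
        have "lmult (site 0 (phase_matrix \<beta> c d) * s) \<in> spin_model v"
          using mult_C[OF _ gen] dv by (simp add: C_def)
        moreover have "lmult (site 0 (phase_matrix \<alpha> a b ** phase_matrix \<beta> c d) * s)
            = lmult (site 0 (phase_matrix \<alpha> a b)) o\<^sub>L lmult (site 0 (phase_matrix \<beta> c d) * s)"
          by (simp add: mult.assoc flip: lmult_ops(2) site_mult)
        ultimately show ?thesis using du unfolding product_span_def by (intro op.span_base) blast
      qed
      obtain a b c d where m: "m = phase_matrix \<alpha> a b ** phase_matrix \<beta> 1 0
          + phase_matrix \<alpha> 1 0 ** phase_matrix \<beta> 0 c + phase_matrix \<alpha> 0 1 ** phase_matrix \<beta> 0 d"
        using phase_matrix_products_span[OF sin] by metis
      show ?case
        unfolding m site_add distrib_right lmult_ops(1)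
        using sp unfolding product_span_def by (intro op.span_add)
    next
      case (add X Y)
      then show ?case unfolding lmult_ops(1) product_span_def by (intro op.span_add)
    qed
  qed
  then show "hyperfinite_R \<subseteq> strong_operator_topology closure_of product_span (spin_model u) (spin_model v)"
    unfolding hyperfinite_R_eq by (intro closure_of_mono) auto
qed

theorem proposition6p15:
  fixes \<alpha> \<beta> :: real and u v :: "complex ^ 2 ^ 2"
  assumes "\<alpha> \<in> {0..<2 * pi}" and "\<beta> \<in> {0..<2 * pi}"
    and "\<beta> \<notin> {\<alpha>, \<alpha> + pi, \<alpha> - pi}"
    and "u = (1 / sqrt 2) *\<^sub>R vector [vector [1, 1],
           vector [exp (\<i> * of_real \<alpha>), - exp (\<i> * of_real \<alpha>)]]"
    and "v = (1 / sqrt 2) *\<^sub>R vector [vector [1, 1],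
           vector [exp (\<i> * of_real \<beta>), - exp (\<i> * of_real \<beta>)]]"
  shows "nondegenerate_quadruple (spin_model u \<inter> spin_model v) (spin_model u) (spin_model v) hyperfinite_R"
proof -
  have sin: "sin (\<beta> - \<alpha>) \<noteq> 0"
  proof
    assume "sin (\<beta> - \<alpha>) = 0"
    then obtain i :: int where i: "\<beta> - \<alpha> = of_int i * pi" unfolding sin_zero_iff_int2 by blast
    have "\<beta> - \<alpha> < 2 * pi" "(-2) * pi < \<beta> - \<alpha>" using assms(1,2) by auto
    then have "of_int i < (2 :: real)" "(-2 :: real) < of_int i"
      unfolding i mult_less_cancel_right_pos[OF pi_gt_zero] by auto
    then have "i = -1 \<or> i = 0 \<or> i = 1" by linarith
    with i assms(3) show False by auto
  qed
  then have sin': "sin (\<alpha> - \<beta>) \<noteq> 0" by (metis minus_diff_eq neg_equal_0_iff_equal sin_minus)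
  have "von_neumann_algebra (\<Inter>{spin_model u, spin_model v})"
    by (rule von_neumann_algebra_Inter) (auto simp: spin_model_von_neumann)
  then show ?thesis
    unfolding nondegenerate_quadruple_def
    using spin_model_von_neumann[of u] spin_model_von_neumann[of v] von_neumann_algebra_hyperfinite_R
      product_span_spin_models_dense[OF assms(4,5) sin] product_span_spin_models_dense[OF assms(5,4) sin']
    by simp
qed

end
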